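(* Let $p>1$. There exists a constant $h_*>0$ such that the following holds. Let $\psi$ be a symmetric cone obstacle satisfying the obstacle assumptions below. (i) If $\psi(\tfrac12) < h_*$, then there is a unique minimizer $u\in M_{\rm sym}(\psi)$ of $\mathcal{E}_p$ in $M_{\rm sym}(\psi)$. (ii) If $\psi(\tfrac12)\ge h_*$, then there is no minimizer of $\mathcal{E}_p$ in $M(\psi)$.
   Context: For $u \in W^{2,p}(0,1)$ let $\kappa_u = u''/(1+(u')^2)^{3/2}$ be the curvature of its graph and $\mathcal{E}_p(u) := \int_0^1 |\kappa_u|^p\sqrt{1+(u')^2}\,dx$ (equivalently $\mathcal{E}_p(u)=\int_0^1|(EU_p(u'))'|^p dx$ with $EU_p(z)=\int_0^z(1+s^2)^{-\frac32+\frac1{2p}}ds$). Obstacle assumptions: $\psi\in C^0([0,1])$, $\psi(0)<0$, $\psi(1)<0$, and $\psi(x_0)>0$ for some $x_0\in(0,1)$. A symmetric cone obstacle is a $\psi\in C^0([0,1])$ such that $\psi|_{[0,1/2]}$ and $\psi|_{[1/2,1]}$ are affine linear and $\psi(x)=\psi(1-x)$ for $x\in[0,1]$. $M(\psi) := \{ v \in W^{2,p}(0,1)\cap W^{1,p}_0(0,1) : v \ge \psi \text{ on } [0,1]\}$ and $M_{\rm sym}(\psi) := \{ v\in M(\psi) : v(x)=v(1-x) \text{ for } x\in[0,1]\}$. *)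

theory Defs
  imports "HOL-Analysis.Analysis"
begin

text \<open>Sobolev space W^{2,p}(0,1), via the standard 1D characterisation: u is (on [0,1])
  the integral of a continuous u1, which in turn is the integral of some g in L^p(0,1)
  (g is the weak second derivative).\<close>
definition W2p :: "real \<Rightarrow> (real \<Rightarrow> real) \<Rightarrow> bool" where
  "W2p p u \<longleftrightarrow> (\<exists>u1 g.
      set_integrable lebesgue {0..1} g \<and>
      set_integrable lebesgue {0..1} (\<lambda>x. \<bar>g x\<bar> powr p) \<and>
      continuous_on {0..1} u1 \<and>
      (\<forall>x\<in>{0..1}. u1 x = u1 0 + (LINT t:{0..x}|lebesgue. g t)) \<and>
      (\<forall>x\<in>{0..1}. u x = u 0 + (LINT t:{0..x}|lebesgue. u1 t)))"

text \<open>Curvature of the graph; u' and u'' are the (classical, a.e.) derivatives on (0,1).\<close>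
definition curv :: "(real \<Rightarrow> real) \<Rightarrow> real \<Rightarrow> real" where
  "curv u x = deriv (deriv u) x / (1 + (deriv u x)\<^sup>2) powr (3/2)"

definition Ep :: "real \<Rightarrow> (real \<Rightarrow> real) \<Rightarrow> real" where
  "Ep p u = (LINT x:{0..1}|lebesgue. \<bar>curv u x\<bar> powr p * sqrt (1 + (deriv u x)\<^sup>2))"

definition obstacle_assms :: "(real \<Rightarrow> real) \<Rightarrow> bool" where
  "obstacle_assms \<psi> \<longleftrightarrow> continuous_on {0..1} \<psi> \<and> \<psi> 0 < 0 \<and> \<psi> 1 < 0 \<and>
     (\<exists>x0\<in>{0<..<1}. \<psi> x0 > 0)"

definition sym_cone_obstacle :: "(real \<Rightarrow> real) \<Rightarrow> bool" where
  "sym_cone_obstacle \<psi> \<longleftrightarrow> continuous_on {0..1} \<psi> \<and>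
     (\<exists>a b. \<forall>x\<in>{0..1/2}. \<psi> x = a * x + b) \<and>
     (\<exists>a b. \<forall>x\<in>{1/2..1}. \<psi> x = a * x + b) \<and>
     (\<forall>x\<in>{0..1}. \<psi> x = \<psi> (1 - x))"

definition Mset :: "real \<Rightarrow> (real \<Rightarrow> real) \<Rightarrow> (real \<Rightarrow> real) set" where
  "Mset p \<psi> = {v. W2p p v \<and> v 0 = 0 \<and> v 1 = 0 \<and> (\<forall>x\<in>{0..1}. v x \<ge> \<psi> x)}"

definition Msym :: "real \<Rightarrow> (real \<Rightarrow> real) \<Rightarrow> (real \<Rightarrow> real) set" where
  "Msym p \<psi> = {v \<in> Mset p \<psi>. \<forall>x\<in>{0..1}. v x = v (1 - x)}"

definition is_minimizer :: "real \<Rightarrow> (real \<Rightarrow> real) set \<Rightarrow> (real \<Rightarrow> real) \<Rightarrow> bool" where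
  "is_minimizer p M u \<longleftrightarrow> u \<in> M \<and> (\<forall>v\<in>M. Ep p u \<le> Ep p v)"

end

theory Submission
  imports Defs
begin

text \<open>
  Write \<open>\<theta> = arctan u'\<close> for the tangent angle and let \<open>\<alpha>\<close> be its maximum on the left half. Since
  \<open>sin (\<alpha> - \<theta>) ds = (sin \<alpha> - u' cos \<alpha>) dx\<close>, the integral of \<open>sin (\<alpha> - \<theta>)\<close> over the left half depends on \<open>u\<close>
  only through \<open>u (1/2)\<close>. Young's inequality bounds \<open>|\<kappa>|^p\<close> below by a combination of \<open>sin (\<alpha> - \<theta>)\<close> and
  \<open>|\<kappa>| sin (\<alpha> - \<theta>)^(1 - 1/p)\<close>, and the second term integrates exactly in \<open>\<theta>\<close>. Adding the two halves,
  with the two maximal angles replaced by their mean, gives \<open>E_p u \<ge> 2 J(\<alpha>)\<close> for an explicit function \<open>J\<close>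
  of some \<open>\<alpha> < pi/2\<close>, even without symmetry. The sign of \<open>J'\<close> is that of \<open>Y(\<alpha>) / (2 X(\<alpha>)) - h\<close>, where
  \<open>h = \<psi> (1/2)\<close> and \<open>X\<close>, \<open>Y\<close> are the width and height of the arc of the free p-elastica that starts at an
  inflection point with angle \<open>\<alpha>\<close> and ends horizontally; \<open>Y / X\<close> is strictly increasing. So below
  \<open>h_* = Y(pi/2) / (2 X(pi/2))\<close> the function \<open>J\<close> has a unique minimum, attained by the rescaled elastica
  arc, whereas for \<open>h \<ge> h_*\<close> it decreases strictly to a limit at \<open>pi/2\<close> that is approached by arcs
  prolonged by short steep segments, but never attained.
\<close>

section \<open>Lebesgue differentiation on the line\<close>

text \<open>The energy does not control the slope: \<open>elastic_weight p\<close> is integrable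
  over the whole line, so energies stay bounded while slopes blow up, and weak compactness does not
  produce a minimizer. Hence a calibration, whose integrand is read off from the free elastica:
  along it |\<kappa>|^p = t^p sin (\<alpha> - \<theta>) for a constant t, and exactly then Young's
  inequality is an equality. The curvature vanishes where \<theta> = \<alpha>, which is the natural
  boundary condition at the ends of the interval. Taking the maximal angle for \<alpha> keeps sin
  (\<alpha> - \<theta>) nonnegative and makes the boundary term there vanish. In the general bound
  the scale t stays free until both halves have been added; optimizing it then yields J. The
  equality case comes from the same inequality: the deficit is the integral of a nonnegative
  function, so an energy equal to the bound forces the elastica equation almost everywhere. As
  \<open>curv\<close> is built from \<open>deriv (deriv u)\<close> while the Sobolev condition
  supplies only an integrable g, Lebesgue's differentiation theorem is needed to identify the two
  almost everywhere.\<close>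

lemma outer_open_integral_small:
  fixes f :: "real \<Rightarrow> real"
  assumes f: "integrable lebesgue f" and A: "A \<in> sets lebesgue" and e: "e > 0"
  obtains U where "open U" "A \<subseteq> U" "U - A \<in> lmeasurable" "measure lebesgue (U - A) < e"
    "(LINT x:U - A|lebesgue. \<bar>f x\<bar>) < e"
proof -
  have "\<exists>T. open T \<and> A \<subseteq> T \<and> T - A \<in> lmeasurable \<and> emeasure lebesgue (T - A) < ennreal (1 / Suc n)" for n
    using sets_lebesgue_outer_open[OF A, of "1 / Suc n"] by (metis of_nat_0_less_iff zero_less_Suc zero_less_divide_1_iff)
  then obtain T where T: "\<And>n. open (T n)" "\<And>n. A \<subseteq> T n" "\<And>n. T n - A \<in> lmeasurable"
      "\<And>n. emeasure lebesgue (T n - A) < ennreal (1 / Suc n)"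
    by metis
  \<comment> \<open>Finite intersections make the excesses over \<open>A\<close> decreasing, with
    null intersection, so the integral of |f| over them tends to 0 by continuity from above.\<close>
  define V where "V n = (\<Inter>k\<le>n. T k)" for n
  have Vo: "open (V n)" for n unfolding V_def using T(1) by (intro open_INT) auto
  have AV: "A \<subseteq> V n" for n unfolding V_def using T(2) by auto
  have VT: "V n - A \<subseteq> T n - A" for n unfolding V_def by auto
  have Vm: "V n - A \<in> sets lebesgue" for n
    using Vo A by (metis sets.Diff sets_completionI_sets lborelD_Collect borel_open sets_lborel)
  have VL: "V n - A \<in> lmeasurable" for n
    using fmeasurableI2[OF T(3) VT Vm] .
  have mV: "measure lebesgue (V n - A) < 1 / Suc n" for n
  proof -
    have "measure lebesgue (V n - A) \<le> measure lebesgue (T n - A)"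
      using measure_mono_fmeasurable[OF VT Vm T(3)] .
    also have "\<dots> < 1 / Suc n"
      using T(4)[of n] emeasure_eq_measure2[OF T(3)[of n]] by (simp add: ennreal_less_iff)
    finally show ?thesis .
  qed
  have dec: "decseq (\<lambda>n. V n - A)"
    unfolding V_def decseq_def by auto
  have "(\<lambda>n. LINT x:V n - A|lebesgue. \<bar>f x\<bar>) \<longlonglongrightarrow> (LINT x:(\<Inter>n. V n - A)|lebesgue. \<bar>f x\<bar>)"
  proof (rule set_integral_cont_down[OF _ dec])
    show "set_integrable lebesgue (V 0 - A) (\<lambda>x. \<bar>f x\<bar>)"
      unfolding set_integrable_def using f Vm[of 0] by (intro integrable_mult_indicator) auto
  qed (use Vm in auto)
  moreover have meas: "(\<Inter>n. V n - A) \<in> sets lebesgue" using Vm by (intro sets.countable_INT) auto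
  have "(LINT x:(\<Inter>n. V n - A)|lebesgue. \<bar>f x\<bar>) = (LINT x:{}|lebesgue. \<bar>f x\<bar>)"
  proof (rule set_integral_null_delta)
    have "measure lebesgue (\<Inter>n. V n - A) \<le> 1 / Suc n" for n
    proof -
      have "measure lebesgue (\<Inter>n. V n - A) \<le> measure lebesgue (V n - A)"
        by (rule measure_mono_fmeasurable[OF _ meas VL]) auto
      with mV[of n] show ?thesis by simp
    qed
    then have "measure lebesgue (\<Inter>n. V n - A) \<le> 0"
      by (intro LIMSEQ_le_const[OF LIMSEQ_inverse_real_of_nat]) (auto simp: inverse_eq_divide)
    moreover have "(\<Inter>n. V n - A) \<in> lmeasurable"
      by (rule fmeasurableI2[OF VL _ meas]) auto
    ultimately have "emeasure lebesgue (\<Inter>n. V n - A) = 0"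
      by (simp add: emeasure_eq_measure2 ennreal_neg)
    then show "sym_diff (\<Inter>n. V n - A) {} \<in> null_sets lebesgue"
      using meas by auto
  qed (use f meas in auto)
  then have "(LINT x:(\<Inter>n. V n - A)|lebesgue. \<bar>f x\<bar>) = 0"
    by (simp add: set_lebesgue_integral_def)
  ultimately have "(\<lambda>n. LINT x:V n - A|lebesgue. \<bar>f x\<bar>) \<longlonglongrightarrow> 0" by simp
  then have "\<forall>\<^sub>F n in sequentially. (LINT x:V n - A|lebesgue. \<bar>f x\<bar>) < e"
    using e order_tendstoD(2) by blast
  moreover have "\<forall>\<^sub>F n in sequentially. inverse (real (Suc n)) < e"
    using e order_tendstoD(2)[OF LIMSEQ_inverse_real_of_nat] by blast
  ultimately have "\<forall>\<^sub>F n in sequentially. (LINT x:V n - A|lebesgue. \<bar>f x\<bar>) < e \<and> inverse (real (Suc n)) < e"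
    by eventually_elim auto
  then obtain n where n: "(LINT x:V n - A|lebesgue. \<bar>f x\<bar>) < e" "inverse (real (Suc n)) < e"
    by (auto simp: eventually_sequentially)
  show ?thesis
    using that[OF Vo AV VL _ n(1)] mV[of n] n(2) by (simp add: inverse_eq_divide)
qed

text \<open>Vitali covering: on disjoint intervals where the average of f is at least s, the
  integral of f - r is at least (s - r) times their total length. But f - r is negative on {f < r},
  so this integral is at most that of |f| + |r| over the small excess of an open superset.\<close>

lemma negligible_upper_average_gt:
  fixes f :: "real \<Rightarrow> real"
  assumes f: "integrable lebesgue f" and rs: "r < s"
  shows "negligible {x. f x < r \<and> (\<forall>d>0. \<exists>a b. a < b \<and> x \<in> {a..b} \<and> b - a < d \<and>
             s * (b - a) \<le> (LINT t:{a..b}|lebesgue. f t))}" (is "negligible ?E")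
  unfolding negligible_outer_le
proof (intro allI impI)
  fix e :: real assume e: "e > 0"
  define A where "A = {x. f x < r}"
  have [measurable]: "f \<in> borel_measurable lebesgue" using f by auto
  have A: "A \<in> sets lebesgue" unfolding A_def
    using borel_measurable_less[of f lebesgue "\<lambda>_. r"] by (simp add: pred_def)
  \<comment> \<open>Chosen so that the final bound e1 (1 + |r|), divided by s - r, is exactly
    e.\<close>
  define e1 where "e1 = e * (s - r) / (1 + \<bar>r\<bar>)"
  have e1: "e1 > 0" unfolding e1_def using e rs by (auto intro!: divide_pos_pos mult_pos_pos)
  obtain U where U: "open U" "A \<subseteq> U" "U - A \<in> lmeasurable" "measure lebesgue (U - A) < e1"
      "(LINT x:U - A|lebesgue. \<bar>f x\<bar>) < e1"
    using outer_open_integral_small[OF f A e1] .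
  define K where "K = {(a,b). a < b \<and> {a..b} \<subseteq> U \<and> s * (b - a) \<le> (LINT t:{a..b}|lebesgue. f t)}"
  define c where "c = (\<lambda>(a::real,b). (a + b) / 2)"
  define \<rho> where "\<rho> = (\<lambda>(a::real,b). (b - a) / 2)"
  have cb: "cball (c i) (\<rho> i) = {fst i..snd i}" for i
    by (auto simp: c_def \<rho>_def cball_eq_atLeastAtMost field_simps split: prod.splits)
  have cov: "\<exists>i. i \<in> K \<and> x \<in> cball (c i) (\<rho> i) \<and> \<rho> i < d" if x: "x \<in> ?E" and d: "d > 0" for x d
  proof -
    have "x \<in> U" using x U(2) by (auto simp: A_def)
    then obtain d' where d': "d' > 0" "ball x d' \<subseteq> U"
      using U(1) openE by blast
    obtain a b where ab: "a < b" "x \<in> {a..b}" "b - a < min d d'" "s * (b - a) \<le> (LINT t:{a..b}|lebesgue. f t)"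
      using x d d' by (auto simp: ) (metis min_less_iff_conj)
    have "{a..b} \<subseteq> ball x d'" using ab by (auto simp: dist_real_def)
    then have "(a,b) \<in> K" using ab d' by (auto simp: K_def)
    moreover have "\<rho> (a,b) < d" using ab by (auto simp: \<rho>_def)
    ultimately show ?thesis using ab(2) cb[of "(a,b)"] by fastforce
  qed
  have pos: "\<rho> i > 0" if "i \<in> K" for i using that by (auto simp: K_def \<rho>_def)
  obtain C where C: "countable C" "C \<subseteq> K"
      "pairwise (\<lambda>i j. disjnt (cball (c i) (\<rho> i)) (cball (c j) (\<rho> j))) C"
      "negligible (?E - (\<Union>i\<in>C. cball (c i) (\<rho> i)))"
    by (rule Vitali_covering_theorem_cballs[OF pos cov])
  let ?I = "\<lambda>i. {fst i..snd i :: real}"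
  have bound: "measure lebesgue (\<Union>(?I ` D)) \<le> e" if D: "D \<subseteq> C" "finite D" for D
  proof -
    let ?N = "\<Union>i\<in>D. ?I i"
    have fi: "set_integrable lebesgue S f" if "S \<in> sets lebesgue" for S
      unfolding set_integrable_def using f that by (intro integrable_mult_indicator)
    have ri: "set_integrable lebesgue S (\<lambda>_. q)" if "S \<in> lmeasurable" for S and q :: real
      unfolding set_integrable_def real_scaleR_def using that
      by (intro integrable_mult_left impI integrable_real_indicator) (auto simp: fmeasurable_def)
    have fri: "set_integrable lebesgue S (\<lambda>x. f x - r)" if "S \<in> lmeasurable" for S
      using set_integral_diff(1)[OF fi[of S] ri[of S r]] that by (simp add: fmeasurableD)
    have fri': "set_integrable lebesgue S (\<lambda>x. \<bar>f x\<bar> + \<bar>r\<bar>)" if "S \<in> lmeasurable" for S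
      using set_integral_add(1)[OF set_integrable_abs[OF fi[of S]] ri[of S "\<bar>r\<bar>"]] that by (simp add: fmeasurableD)
    have NL: "?N \<in> lmeasurable" using D(2) by (intro fmeasurable.finite_UN) auto
    have NU: "?N \<subseteq> U" using D C(2) by (force simp: K_def)
    have disj: "?I i \<inter> ?I j = {}" if "i \<in> D" "j \<in> D" "i \<noteq> j" for i j
      using C(3) that D(1) unfolding pairwise_def cb disjnt_def by blast
    have len: "(s - r) * measure lebesgue (?I i) \<le> (LINT x:?I i|lebesgue. f x - r)" if "i \<in> D" for i
    proof -
      have i: "fst i < snd i" "s * (snd i - fst i) \<le> (LINT x:?I i|lebesgue. f x)"
        using that D C(2) by (auto simp: K_def)
      have "(LINT x:?I i|lebesgue. f x - r) = (LINT x:?I i|lebesgue. f x) - (LINT x:?I i|lebesgue. r)"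
        by (rule set_integral_diff(2)) (auto intro: fi ri)
      also have "(LINT x:?I i|lebesgue. r) = (snd i - fst i) * r"
        using i(1) by (simp add: set_lebesgue_integral_def)
      finally show ?thesis using i by (simp add: algebra_simps)
    qed
    have UAs: "U - A \<in> sets lebesgue" using U(3) by auto
    have "(s - r) * measure lebesgue ?N \<le> (s - r) * (\<Sum>i\<in>D. measure lebesgue (?I i))"
      using rs D(2) by (intro mult_left_mono measure_UNION_le) auto
    also have "\<dots> \<le> (\<Sum>i\<in>D. LINT x:?I i|lebesgue. f x - r)"
      unfolding sum_distrib_left by (intro sum_mono len)
    also have "\<dots> = (LINT x:?N|lebesgue. f x - r)"
      by (rule set_integral_finite_Union[symmetric])
         (use D(2) disj in \<open>auto intro!: fri simp: disjoint_family_on_def\<close>)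
    also have "\<dots> \<le> (LINT x:U - A|lebesgue. \<bar>f x\<bar> + \<bar>r\<bar>)"
      unfolding set_lebesgue_integral_def
    proof (rule integral_mono)
      show "integrable lebesgue (\<lambda>x. indicat_real ?N x *\<^sub>R (f x - r))"
        using fri[OF NL] by (simp add: set_integrable_def)
      show "integrable lebesgue (\<lambda>x. indicat_real (U - A) x *\<^sub>R (\<bar>f x\<bar> + \<bar>r\<bar>))"
        using fri'[OF U(3)] by (simp add: set_integrable_def)
      show "indicat_real ?N x *\<^sub>R (f x - r) \<le> indicat_real (U - A) x *\<^sub>R (\<bar>f x\<bar> + \<bar>r\<bar>)" for x
        using subsetD[OF NU, of x] by (cases "x \<in> ?N"; cases "x \<in> A") (auto simp: A_def indicator_def simp del: UN_iff)
    qed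
    also have "\<dots> = (LINT x:U - A|lebesgue. \<bar>f x\<bar>) + (LINT x:U - A|lebesgue. \<bar>r\<bar>)"
      by (rule set_integral_add(2)[OF set_integrable_abs[OF fi] ri]) (use U UAs in auto)
    also have "(LINT x:U - A|lebesgue. \<bar>r\<bar>) = measure lebesgue (U - A) * \<bar>r\<bar>"
      using U(3) by (simp add: set_lebesgue_integral_def)
    also have "(LINT x:U - A|lebesgue. \<bar>f x\<bar>) + measure lebesgue (U - A) * \<bar>r\<bar> \<le> e1 + e1 * \<bar>r\<bar>"
      using U(4,5) by (intro add_mono mult_right_mono) auto
    also have "\<dots> = e1 * (1 + \<bar>r\<bar>)" by (simp add: algebra_simps)
    also have "\<dots> = e * (s - r)"
      using abs_ge_zero[of r] by (simp add: e1_def)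
    finally show ?thesis using rs by (simp add: mult.commute)
  qed
  have NL: "(\<Union>i\<in>C. ?I i) \<in> lmeasurable" and Ne: "measure lebesgue (\<Union>i\<in>C. ?I i) \<le> e"
    using fmeasurable_UN_bound[OF C(1), of ?I lebesgue e] measure_UN_bound[OF C(1), of ?I lebesgue e] bound by auto
  define N where "N = (\<Union>i\<in>C. ?I i)"
  define Z where "Z = ?E - N"
  have Z: "negligible Z" using C(4) by (simp add: cb Z_def N_def)
  note ZL = negligible_imp_measurable[OF Z]
  have "?E \<subseteq> N \<union> Z" unfolding Z_def by blast
  moreover have "N \<union> Z \<in> lmeasurable"
    using NL ZL by (auto simp: N_def)
  moreover have "measure lebesgue (N \<union> Z) \<le> e"
    using measure_Un_le[of N lebesgue Z] NL ZL Ne negligible_imp_measure0[OF Z]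
    by (auto simp: N_def dest!: fmeasurableD)
  ultimately show "\<exists>T. ?E \<subseteq> T \<and> T \<in> lmeasurable \<and> measure lebesgue T \<le> e" by blast
qed

text \<open>Rationals r < s squeezed strictly between f x and f x + e reduce the exceptional set to
  a countable union of the null sets of the previous lemma.\<close>

lemma AE_interval_average_less:
  fixes f :: "real \<Rightarrow> real"
  assumes f: "integrable lebesgue f"
  shows "AE x in lebesgue. \<forall>e>0. \<exists>d>0. \<forall>a b. a < b \<and> x \<in> {a..b} \<and> b - a < d \<longrightarrow>
           (LINT t:{a..b}|lebesgue. f t) < (f x + e) * (b - a)"
proof -
  define E where "E r s = {x. f x < r \<and> (\<forall>d>0. \<exists>a b. a < b \<and> x \<in> {a..b} \<and> b - a < d \<and>
             s * (b - a) \<le> (LINT t:{a..b}|lebesgue. f t))}" for r s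
  have "AE x in lebesgue. x \<notin> E r s" if "r < s" for r s
    using negligible_upper_average_gt[OF f that, folded E_def]
    by (simp only: negligible_iff_null_sets) (rule AE_not_in)
  then have "AE x in lebesgue. r < s \<longrightarrow> x \<notin> E r s" for r s
    by (cases "r < s") auto
  then have "AE x in lebesgue. \<forall>q\<in>\<rat> \<times> \<rat>. fst q < snd q \<longrightarrow> x \<notin> E (fst q) (snd q)"
    using countable_rat by (intro AE_ball_countable') auto
  then show ?thesis
  proof eventually_elim
    case (elim x)
    show ?case
    proof (intro allI impI)
      fix e :: real assume "e > 0"
      then obtain s where s: "s \<in> \<rat>" "f x < s" "s < f x + e"
        using Rats_dense_in_real[of "f x" "f x + e"] by auto
      obtain r where r: "r \<in> \<rat>" "f x < r" "r < s"
        using Rats_dense_in_real[OF s(2)] by auto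
      have "x \<notin> E r s" using elim r s by fastforce
      then obtain d where d: "d > 0" "\<And>a b. a < b \<Longrightarrow> x \<in> {a..b} \<Longrightarrow> b - a < d \<Longrightarrow>
          (LINT t:{a..b}|lebesgue. f t) < s * (b - a)"
        using r(2) unfolding E_def mem_Collect_eq by (meson not_le)
      have "(LINT t:{a..b}|lebesgue. f t) < (f x + e) * (b - a)"
        if "a < b" "x \<in> {a..b}" "b - a < d" for a b
      proof -
        have "s * (b - a) \<le> (f x + e) * (b - a)"
          using that s by (intro mult_right_mono) auto
        with d(2)[OF that] show ?thesis by simp
      qed
      with d(1) show "\<exists>d>0. \<forall>a b. a < b \<and> x \<in> {a..b} \<and> b - a < d \<longrightarrow>
           (LINT t:{a..b}|lebesgue. f t) < (f x + e) * (b - a)" by blast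
    qed
  qed
qed

text \<open>Upper bounds for the averages of F and of -F give two-sided control. The intervals only
  have to contain x, so those with x as an endpoint yield both one-sided difference
  quotients.\<close>

theorem AE_has_real_derivative_indefinite_integral:
  fixes f :: "real \<Rightarrow> real"
  assumes f: "f absolutely_integrable_on {a..b}"
  shows "AE x in lebesgue. x \<in> {a<..<b} \<longrightarrow>
           ((\<lambda>y. integral {a..y} f) has_real_derivative f x) (at x)"
proof -
  define F where "F x = indicator {a..b} x *\<^sub>R f x" for x
  have F: "integrable lebesgue F"
    using f unfolding set_integrable_def F_def .
  have AE1: "AE x in lebesgue. \<forall>e>0. \<exists>d>0. \<forall>a b. a < b \<and> x \<in> {a..b} \<and> b - a < d \<longrightarrow>
           (LINT t:{a..b}|lebesgue. F t) < (F x + e) * (b - a)"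
    by (rule AE_interval_average_less[OF F])
  have AE2: "AE x in lebesgue. \<forall>e>0. \<exists>d>0. \<forall>a b. a < b \<and> x \<in> {a..b} \<and> b - a < d \<longrightarrow>
           (LINT t:{a..b}|lebesgue. - F t) < (- F x + e) * (b - a)"
    using F by (intro AE_interval_average_less) auto
  have int: "f integrable_on {a..b}"
    using f by (rule set_lebesgue_integral_eq_integral)
  have diff: "integral {a..d} f - integral {a..c} f = (LINT t:{c..d}|lebesgue. F t)"
    if "a \<le> c" "c \<le> d" "d \<le> b" for c d
  proof -
    have "integral {a..c} f + integral {c..d} f = integral {a..d} f"
      using that by (intro Henstock_Kurzweil_Integration.integral_combine integrable_subinterval_real[OF int]) auto
    moreover have "(LINT t:{c..d}|lebesgue. F t) = (LINT t:{c..d}|lebesgue. f t)"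
      using that by (intro set_lebesgue_integral_cong) (auto simp: F_def)
    moreover have "\<dots> = integral {c..d} f"
      using that by (intro set_lebesgue_integral_eq_integral absolutely_integrable_on_subinterval[OF f]) auto
    ultimately show ?thesis by simp
  qed
  from AE1 AE2 show ?thesis
  proof eventually_elim
    case (elim x)
    show ?case
    proof
      assume x: "x \<in> {a<..<b}"
      then have Fx: "F x = f x" by (simp add: F_def)
      show "((\<lambda>y. integral {a..y} f) has_real_derivative f x) (at x)"
        unfolding has_field_derivative_iff LIM_eq
      proof (intro allI impI)
        fix e :: real assume e: "e > 0"
        obtain d1 where d1: "d1 > 0" "\<And>u v. u < v \<and> x \<in> {u..v} \<and> v - u < d1 \<Longrightarrow>
           (LINT t:{u..v}|lebesgue. F t) < (F x + e) * (v - u)"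
          using elim(1) e by blast
        obtain d2 where d2: "d2 > 0" "\<And>u v. u < v \<and> x \<in> {u..v} \<and> v - u < d2 \<Longrightarrow>
           (LINT t:{u..v}|lebesgue. - F t) < (- F x + e) * (v - u)"
          using elim(2) e by blast
        define d where "d = min (min d1 d2) (min (x - a) (b - x))"
        have d: "d > 0" using d1 d2 x by (auto simp: d_def)
        have neg: "(LINT t:{u..v}|lebesgue. - F t) = - (LINT t:{u..v}|lebesgue. F t)" for u v
          by (simp add: set_lebesgue_integral_def)
        have key: "\<bar>(LINT t:{u..v}|lebesgue. F t) / (v - u) - f x\<bar> < e"
          if "u < v" "x \<in> {u..v}" "v - u < d" for u v
        proof -
          have "(LINT t:{u..v}|lebesgue. F t) < (f x + e) * (v - u)"
            "(f x - e) * (v - u) < (LINT t:{u..v}|lebesgue. F t)"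
            using d1(2)[of u v] d2(2)[of u v] that by (auto simp: d_def Fx neg algebra_simps)
          then have "(LINT t:{u..v}|lebesgue. F t) / (v - u) < f x + e"
            "f x - e < (LINT t:{u..v}|lebesgue. F t) / (v - u)"
            using that(1) by (simp_all add: pos_divide_less_eq pos_less_divide_eq)
          then show ?thesis by linarith
        qed
        show "\<exists>s>0. \<forall>y. y \<noteq> x \<and> norm (y - x) < s \<longrightarrow>
            norm ((integral {a..y} f - integral {a..x} f) / (y - x) - f x) < e"
        proof (intro exI[of _ d] conjI allI impI d)
          fix y assume y: "y \<noteq> x \<and> norm (y - x) < d"
          then have yab: "a \<le> y" "y \<le> b" by (auto simp: d_def)
          consider "x < y" | "y < x" using y by linarith
          then show "norm ((integral {a..y} f - integral {a..x} f) / (y - x) - f x) < e"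
          proof cases
            case 1
            then show ?thesis using key[of x y] diff[of x y] y x yab by auto
          next
            case 2
            have "(integral {a..y} f - integral {a..x} f) / (y - x) =
                  (integral {a..x} f - integral {a..y} f) / (x - y)"
              using 2 by (simp add: field_simps)
            then show ?thesis using key[of y x] diff[of y x] y x yab 2 by auto
          qed
        qed
      qed
    qed
  qed
qed

section \<open>Absolutely continuous slopes and the energy\<close>

text \<open>The bounds telescope over a fine partition. Increments are measured by \<open>N\<close>,
  later the integral of |g|, because for a merely integrable g they are not bounded by a multiple of
  the interval length.\<close>

lemma eq_if_increments_small:
  fixes W N :: "real \<Rightarrow> real"
  assumes ab: "a \<le> b"
    and W: "\<And>e. e > 0 \<Longrightarrow> \<exists>d>0. \<forall>x y. a \<le> x \<and> x \<le> y \<and> y \<le> b \<and> y - x < d \<longrightarrow>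
                 \<bar>W y - W x\<bar> \<le> e * (N y - N x)"
  shows "W b = W a"
proof -
  have bound: "\<bar>W b - W a\<bar> \<le> e * (N b - N a)" if e: "e > 0" for e
  proof -
    obtain d where d: "d > 0" "\<And>x y. a \<le> x \<Longrightarrow> x \<le> y \<Longrightarrow> y \<le> b \<Longrightarrow> y - x < d \<Longrightarrow>
                 \<bar>W y - W x\<bar> \<le> e * (N y - N x)"
      using W[OF e] by blast
    obtain n :: nat where n: "(b - a) / d < real n" using reals_Archimedean2 by blast
    have n0: "n > 0"
      using n d(1) ab by (metis divide_nonneg_pos diff_ge_0_iff_ge gr_zeroI not_le of_nat_0)
    define x where "x i = a + real i * ((b - a) / n)" for i
    have step: "\<bar>W (x (Suc i)) - W (x i)\<bar> \<le> e * (N (x (Suc i)) - N (x i))" if "i < n" for i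
    proof (rule d(2))
      show "a \<le> x i" using ab by (simp add: x_def)
      show "x i \<le> x (Suc i)" using ab by (simp add: x_def divide_right_mono mult_right_mono)
      have "real (Suc i) * ((b - a) / n) \<le> real n * ((b - a) / n)"
        using that ab by (intro mult_right_mono) auto
      then show "x (Suc i) \<le> b" using n0 by (simp add: x_def)
      have "x (Suc i) - x i = (b - a) / n" by (simp add: x_def algebra_simps add_divide_distrib diff_divide_distrib)
      also have "\<dots> < d" using n d(1) n0 by (simp add: field_simps)
      finally show "x (Suc i) - x i < d" .
    qed
    have ends: "x 0 = a" "x n = b" using n0 by (simp_all add: x_def)
    have "W b - W a = (\<Sum>i<n. W (x (Suc i)) - W (x i))"
      by (simp add: sum_lessThan_telescope[of "\<lambda>i. W (x i)"] ends)
    then have "\<bar>W b - W a\<bar> \<le> (\<Sum>i<n. \<bar>W (x (Suc i)) - W (x i)\<bar>)"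
      by (simp add: sum_abs)
    also have "\<dots> \<le> (\<Sum>i<n. e * (N (x (Suc i)) - N (x i)))"
      by (intro sum_mono step) simp
    also have "\<dots> = e * (N b - N a)"
      by (simp add: sum_distrib_left[symmetric] sum_lessThan_telescope[of "\<lambda>i. N (x i)"] ends)
    finally show ?thesis .
  qed
  show ?thesis
  proof (rule ccontr)
    assume "W b \<noteq> W a"
    then have pos: "\<bar>W b - W a\<bar> > 0" by simp
    define e where "e = \<bar>W b - W a\<bar> / 2 / (\<bar>N b - N a\<bar> + 1)"
    have "e > 0" unfolding e_def using pos by (intro divide_pos_pos) auto
    have "\<bar>W b - W a\<bar> \<le> e * (N b - N a)" using bound[OF \<open>e > 0\<close>] .
    also have "\<dots> \<le> e * (\<bar>N b - N a\<bar> + 1)" using \<open>e > 0\<close> by (intro mult_left_mono) auto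
    also have "\<dots> = \<bar>W b - W a\<bar> / 2"
      using abs_ge_zero[of "N b - N a"] unfolding e_def by (intro nonzero_eq_divide_eq[THEN iffD1]) auto
    finally show False using pos by simp
  qed
qed

lemma continuous_on_indefinite_integral:
  fixes g u :: "real \<Rightarrow> real"
  assumes "g integrable_on {a..b}" "\<And>x. x \<in> {a..b} \<Longrightarrow> u x = u a + integral {a..x} g"
  shows "continuous_on {a..b} u"
proof -
  have "continuous_on {a..b} (\<lambda>x. u a + integral {a..x} g)"
    by (intro continuous_intros indefinite_integral_continuous_1 assms)
  then show ?thesis using assms(2) by (metis (no_types, lifting) continuous_on_cong)
qed

lemma absolutely_integrable_continuous_mult:
  fixes f g :: "real \<Rightarrow> real"
  assumes "continuous_on {a..b} f" "g absolutely_integrable_on {a..b}"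
  shows "(\<lambda>x. f x * g x) absolutely_integrable_on {a..b}"
proof (rule absolutely_integrable_bounded_measurable_product_real)
  show "f \<in> borel_measurable (lebesgue_on {a..b})"
    using assms(1) by (intro continuous_imp_measurable_on_sets_lebesgue) auto
  show "bounded (f ` {a..b})"
    using assms(1) compact_continuous_image compact_imp_bounded by blast
qed (use assms in auto)

text \<open>The library's fundamental theorem needs derivatives off a countable set; here \<open>\<Phi> \<circ> u\<close> is only
  absolutely continuous, so the increments are compared directly on a fine partition.\<close>

lemma integral_chain_rule:
  fixes g u \<Phi> \<phi> :: "real \<Rightarrow> real"
  assumes ab: "a \<le> b" and g: "g absolutely_integrable_on {a..b}"
    and u: "\<And>x. x \<in> {a..b} \<Longrightarrow> u x = u a + integral {a..x} g"
    and \<Phi>: "\<And>z. (\<Phi> has_real_derivative \<phi> z) (at z)" and \<phi>: "continuous_on UNIV \<phi>"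
  shows "integral {a..b} (\<lambda>x. \<phi> (u x) * g x) = \<Phi> (u b) - \<Phi> (u a)"
proof -
  have gi: "g integrable_on {a..b}" "(\<lambda>x. \<bar>g x\<bar>) integrable_on {a..b}"
    using g by (auto simp: absolutely_integrable_on_def)
  have cu: "continuous_on {a..b} u" by (rule continuous_on_indefinite_integral[OF gi(1) u])
  have c\<phi>u: "continuous_on {a..b} (\<lambda>x. \<phi> (u x))"
    by (rule continuous_on_compose2[OF \<phi> cu]) auto
  have pi: "(\<lambda>x. \<phi> (u x) * g x) integrable_on {a..b}"
    using absolutely_integrable_continuous_mult[OF c\<phi>u g] by (auto simp: absolutely_integrable_on_def)
  have uc: "uniformly_continuous_on {a..b} (\<lambda>x. \<phi> (u x))"
    using c\<phi>u by (intro compact_uniformly_continuous) auto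
  define W where "W x = \<Phi> (u x) - integral {a..x} (\<lambda>x. \<phi> (u x) * g x)" for x
  define N where "N x = integral {a..x} (\<lambda>x. \<bar>g x\<bar>)" for x
  have comb: "integral {a..y} f - integral {a..x} f = integral {x..y} f"
    if "f integrable_on {a..b}" "a \<le> x" "x \<le> y" "y \<le> b" for f :: "real \<Rightarrow> real" and x y
  proof -
    have "integral {a..x} f + integral {x..y} f = integral {a..y} f"
      using that by (intro Henstock_Kurzweil_Integration.integral_combine integrable_subinterval_real[OF that(1)]) auto
    then show ?thesis by simp
  qed
  have "W b = W a"
  proof (rule eq_if_increments_small[OF ab, where N=N])
    fix e :: real assume "e > 0"
    then obtain d where d: "d > 0" "\<And>x y. x \<in> {a..b} \<Longrightarrow> y \<in> {a..b} \<Longrightarrow> dist y x < d \<Longrightarrow> dist (\<phi> (u y)) (\<phi> (u x)) < e"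
      using uniformly_continuous_onE[OF uc] by metis
    have "\<bar>W y - W x\<bar> \<le> e * (N y - N x)" if xy: "a \<le> x" "x \<le> y" "y \<le> b" "y - x < d" for x y
    proof -
      have sub: "f integrable_on {x..y}" if "f integrable_on {a..b}" for f :: "real \<Rightarrow> real"
        using that xy by (intro integrable_subinterval_real[OF that]) auto
      \<comment> \<open>The mean value theorem is applied to \<open>\<Phi>\<close> between the
        values of \<open>u\<close>, and the intermediate value theorem pulls the mean point back to
        the domain; \<open>u\<close> itself is only continuous here.\<close>
      have "\<exists>c\<in>{x..y}. \<Phi> (u y) - \<Phi> (u x) = \<phi> (u c) * (u y - u x)"
      proof -
        have cxy: "continuous_on {x..y} u" using cu by (rule continuous_on_subset) (use xy in auto)
        consider "u x < u y" | "u y < u x" | "u x = u y" by linarith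
        then show ?thesis
        proof cases
          case 1
          obtain z where z: "u x < z" "z < u y" "\<Phi> (u y) - \<Phi> (u x) = (u y - u x) * \<phi> z"
            using MVT2[OF 1, of \<Phi> \<phi>] \<Phi> by blast
          obtain c where "c \<in> {x..y}" "u c = z"
            using IVT'[of u x z y] z cxy xy by auto
          with z show ?thesis by (metis mult.commute)
        next
          case 2
          obtain z where z: "u y < z" "z < u x" "\<Phi> (u x) - \<Phi> (u y) = (u x - u y) * \<phi> z"
            using MVT2[OF 2, of \<Phi> \<phi>] \<Phi> by blast
          obtain c where "c \<in> {x..y}" "u c = z"
            using IVT2'[of u y z x] z cxy xy by auto
          moreover have "\<Phi> (u y) - \<Phi> (u x) = \<phi> z * (u y - u x)"
            using z(3) by (simp add: algebra_simps)
          ultimately show ?thesis by blast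
        next
          case 3 then show ?thesis using xy by auto
        qed
      qed
      then obtain c where c: "c \<in> {x..y}" "\<Phi> (u y) - \<Phi> (u x) = \<phi> (u c) * (u y - u x)" by blast
      have "u y - u x = integral {x..y} g"
        using u[of x] u[of y] comb[OF gi(1), of x y] xy by auto
      then have "W y - W x = \<phi> (u c) * integral {x..y} g - integral {x..y} (\<lambda>x. \<phi> (u x) * g x)"
        using c(2) comb[OF pi, of x y] xy by (simp add: W_def)
      also have "\<dots> = integral {x..y} (\<lambda>s. \<phi> (u c) * g s - \<phi> (u s) * g s)"
        by (subst Henstock_Kurzweil_Integration.integral_diff) (use sub[OF gi(1)] sub[OF pi] in \<open>auto intro: integrable_on_mult_right\<close>)
      also have "norm \<dots> \<le> integral {x..y} (\<lambda>s. e * \<bar>g s\<bar>)"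
      proof (rule integral_norm_bound_integral)
        show "(\<lambda>s. \<phi> (u c) * g s - \<phi> (u s) * g s) integrable_on {x..y}"
          using sub[OF gi(1)] sub[OF pi] by (intro integrable_diff integrable_on_mult_right)
        show "(\<lambda>s. e * \<bar>g s\<bar>) integrable_on {x..y}"
          using sub[OF gi(2)] by (rule integrable_on_mult_right)
        fix s assume s: "s \<in> {x..y}"
        have "dist (\<phi> (u c)) (\<phi> (u s)) < e"
          using d(2)[of s c] s c xy by (auto simp: dist_real_def)
        then have "\<bar>\<phi> (u c) - \<phi> (u s)\<bar> * \<bar>g s\<bar> \<le> e * \<bar>g s\<bar>"
          by (intro mult_right_mono) (auto simp: dist_real_def)
        then show "norm (\<phi> (u c) * g s - \<phi> (u s) * g s) \<le> e * \<bar>g s\<bar>"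
          by (simp add: left_diff_distrib[symmetric] abs_mult)
      qed
      also have "\<dots> = e * (N y - N x)"
        using comb[OF gi(2), of x y] xy by (simp add: N_def)
      finally show ?thesis by simp
    qed
    with d(1) show "\<exists>d>0. \<forall>x y. a \<le> x \<and> x \<le> y \<and> y \<le> b \<and> y - x < d \<longrightarrow> \<bar>W y - W x\<bar> \<le> e * (N y - N x)"
      by blast
  qed
  then show ?thesis by (simp add: W_def)
qed

lemma indefinite_integral_rebase:
  fixes g u :: "real \<Rightarrow> real"
  assumes g: "g integrable_on {a..b}" and u: "\<And>x. x \<in> {a..b} \<Longrightarrow> u x = u a + integral {a..x} g"
    and cd: "a \<le> c" "c \<le> d" "d \<le> b"
  shows "u d = u c + integral {c..d} g"
proof -
  have "integral {a..c} g + integral {c..d} g = integral {a..d} g"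
    using cd by (intro Henstock_Kurzweil_Integration.integral_combine integrable_subinterval_real[OF g]) auto
  then show ?thesis using u[of c] u[of d] cd by auto
qed

lemma integral_chain_rule_sub:
  fixes g u \<Phi> \<phi> :: "real \<Rightarrow> real"
  assumes g: "g absolutely_integrable_on {a..b}"
    and u: "\<And>x. x \<in> {a..b} \<Longrightarrow> u x = u a + integral {a..x} g"
    and \<Phi>: "\<And>z. (\<Phi> has_real_derivative \<phi> z) (at z)" and \<phi>: "continuous_on UNIV \<phi>"
    and cd: "a \<le> c" "c \<le> d" "d \<le> b"
  shows "\<Phi> (u d) = \<Phi> (u c) + integral {c..d} (\<lambda>x. \<phi> (u x) * g x)"
proof -
  have gi: "g integrable_on {a..b}" using g by (rule set_lebesgue_integral_eq_integral)
  have "integral {c..d} (\<lambda>x. \<phi> (u x) * g x) = \<Phi> (u d) - \<Phi> (u c)"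
  proof (rule integral_chain_rule[OF cd(2) _ _ \<Phi> \<phi>])
    show "g absolutely_integrable_on {c..d}"
      by (rule absolutely_integrable_on_subinterval[OF g]) (use cd in auto)
    show "u x = u c + integral {c..x} g" if "x \<in> {c..d}" for x
      using that cd by (intro indefinite_integral_rebase[OF gi u]) auto
  qed
  then show ?thesis by simp
qed

text \<open>The derivative of EU_p: multiplied by u'' and taken at z = u', it gives
  (EU_p(u'))'.\<close>

definition elastic_weight :: "real \<Rightarrow> real \<Rightarrow> real" where
  "elastic_weight p z = (1 + z\<^sup>2) powr (1 / (2 * p) - 3 / 2)"

lemma elastic_weight_pos: "elastic_weight p z > 0"
  unfolding elastic_weight_def using add_pos_nonneg[OF zero_less_one zero_le_power2[of z]] by simp

lemma continuous_elastic_weight: "continuous_on S (elastic_weight p)"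
proof -
  have "1 + z\<^sup>2 \<noteq> 0" for z :: real using zero_le_power2[of z] by linarith
  then show ?thesis unfolding elastic_weight_def by (intro continuous_intros) auto
qed

text \<open>The length element is absorbed into the p-th power, since - 3/2 * p + 1/2 = p (1/(2p) -
  3/2).\<close>

lemma curvature_density_eq:
  assumes "p > 0"
  shows "\<bar>g / (1 + z\<^sup>2) powr (3/2)\<bar> powr p * sqrt (1 + z\<^sup>2) = \<bar>elastic_weight p z * g\<bar> powr p"
proof -
  have pos: "1 + z\<^sup>2 > 0" by (simp add: add_pos_nonneg)
  have "\<bar>g / (1 + z\<^sup>2) powr (3/2)\<bar> powr p = \<bar>g\<bar> powr p * (1 + z\<^sup>2) powr (- 3/2 * p)"
  proof -
    have "\<bar>g / (1 + z\<^sup>2) powr (3/2)\<bar> powr p = \<bar>g\<bar> powr p / ((1 + z\<^sup>2) powr (3/2)) powr p"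
      by (simp add: powr_divide)
    also have "\<dots> = \<bar>g\<bar> powr p / (1 + z\<^sup>2) powr (3/2 * p)"
      by (simp only: powr_powr)
    also have "\<dots> = \<bar>g\<bar> powr p * (1 + z\<^sup>2) powr (- (3/2 * p))"
      by (simp only: powr_minus divide_inverse)
    finally show ?thesis by simp
  qed
  then have "\<bar>g / (1 + z\<^sup>2) powr (3/2)\<bar> powr p * sqrt (1 + z\<^sup>2)
      = \<bar>g\<bar> powr p * ((1 + z\<^sup>2) powr (- 3/2 * p) * (1 + z\<^sup>2) powr (1/2))"
    using pos by (simp add: powr_half_sqrt)
  also have "(1 + z\<^sup>2) powr (- 3/2 * p) * (1 + z\<^sup>2) powr (1/2) = (1 + z\<^sup>2) powr ((1 / (2 * p) - 3 / 2) * p)"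
  proof -
    have "- 3/2 * p + 1/2 = (1 / (2 * p) - 3 / 2) * p" using assms by (simp add: field_simps)
    then show ?thesis by (simp only: powr_add[symmetric])
  qed
  also have "\<bar>g\<bar> powr p * \<dots> = \<bar>elastic_weight p z * g\<bar> powr p"
    by (simp add: elastic_weight_def abs_mult powr_mult powr_powr)
  finally show ?thesis .
qed

text \<open>The first derivative exists at every interior point because \<open>u1\<close> is
  continuous, the second only off a null set. The data \<open>u1\<close>, \<open>g\<close> are
  explicit so that the formula applies both to an arbitrary Sobolev function and to the constructed
  graphs.\<close>

lemma Ep_eq_integral:
  assumes p: "p > 1" and g: "g absolutely_integrable_on {0..1}"
    and gp: "(\<lambda>x. \<bar>g x\<bar> powr p) absolutely_integrable_on {0..1}"
    and cu: "continuous_on {0..1} u1"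
    and u1': "\<And>x. x \<in> {0..1} \<Longrightarrow> u1 x = u1 0 + integral {0..x} g"
    and vx': "\<And>x. x \<in> {0..1} \<Longrightarrow> v x = v 0 + integral {0..x} u1"
  shows "(\<lambda>x. \<bar>elastic_weight p (u1 x) * g x\<bar> powr p) integrable_on {0..1}"
    and "Ep p v = integral {0..1} (\<lambda>x. \<bar>elastic_weight p (u1 x) * g x\<bar> powr p)"
proof -
  have dv: "deriv v x = u1 x" if x: "x \<in> {0<..<1}" for x
  proof (rule DERIV_imp_deriv)
    have "((\<lambda>y. v 0 + integral {0..y} u1) has_real_derivative 0 + u1 x) (at x within {0..1})"
      using x by (intro DERIV_add DERIV_const integral_has_real_derivative[OF cu]) auto
    then have "((\<lambda>y. v 0 + integral {0..y} u1) has_real_derivative u1 x) (at x)"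
      using x by (simp add: at_within_Icc_at)
    then show "(v has_real_derivative u1 x) (at x)"
      by (rule has_field_derivative_transform_within_open[where S="{0<..<1}"]) (use x in \<open>auto intro!: vx'[symmetric]\<close>)
  qed
  have "AE x in lebesgue. x \<in> {0<..<1} \<longrightarrow> ((\<lambda>y. integral {0..y} g) has_real_derivative g x) (at x)"
    by (rule AE_has_real_derivative_indefinite_integral[OF g])
  then obtain N where N: "N \<in> null_sets lebesgue"
    "\<And>x. x \<notin> N \<Longrightarrow> x \<in> {0<..<1} \<Longrightarrow> ((\<lambda>y. integral {0..y} g) has_real_derivative g x) (at x)"
    by (rule AE_E3) auto
  have ddv: "deriv (deriv v) x = g x" if x: "x \<in> {0<..<1}" "x \<notin> N" for x
  proof (rule DERIV_imp_deriv)
    have "((\<lambda>y. u1 0 + integral {0..y} g) has_real_derivative 0 + g x) (at x)"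
      using x by (intro DERIV_add DERIV_const N) auto
    then have "((\<lambda>y. u1 0 + integral {0..y} g) has_real_derivative g x) (at x)" by simp
    then show "(deriv v has_real_derivative g x) (at x)"
      by (rule has_field_derivative_transform_within_open[where S="{0<..<1}"]) (use x in \<open>auto simp: dv intro!: u1'[symmetric]\<close>)
  qed
  let ?e = "\<lambda>x. \<bar>elastic_weight p (u1 x) * g x\<bar> powr p"
  have "(\<lambda>x. elastic_weight p (u1 x) powr p * (\<bar>g x\<bar> powr p)) absolutely_integrable_on {0..1}"
  proof (rule absolutely_integrable_continuous_mult[OF _ gp])
    have "continuous_on {0..1} (\<lambda>x. elastic_weight p (u1 x))"
      by (rule continuous_on_compose2[OF continuous_elastic_weight cu]) auto
    then show "continuous_on {0..1} (\<lambda>x. elastic_weight p (u1 x) powr p)"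
      using elastic_weight_pos by (intro continuous_intros) (auto simp: less_imp_neq[symmetric])
  qed
  moreover have "(\<lambda>x. elastic_weight p (u1 x) powr p * (\<bar>g x\<bar> powr p)) = ?e"
    using elastic_weight_pos by (auto simp: abs_mult powr_mult less_imp_le)
  ultimately have ei: "?e absolutely_integrable_on {0..1}" by simp
  have neg: "negligible (N \<union> {0,1})"
    using N(1) by (simp add: negligible_iff_null_sets[symmetric] insert_commute)
  have spike: "\<bar>curv v x\<bar> powr p * sqrt (1 + (deriv v x)\<^sup>2) = ?e x" if "x \<in> {0..1} - (N \<union> {0,1})" for x
    using that dv[of x] ddv[of x] curvature_density_eq[of p "g x" "u1 x"] p by (simp add: curv_def)
  have "(\<lambda>x. \<bar>curv v x\<bar> powr p * sqrt (1 + (deriv v x)\<^sup>2)) absolutely_integrable_on {0..1}"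
    by (rule absolutely_integrable_spike[OF ei neg spike])
  then have "Ep p v = integral {0..1} (\<lambda>x. \<bar>curv v x\<bar> powr p * sqrt (1 + (deriv v x)\<^sup>2))"
    unfolding Ep_def by (rule set_lebesgue_integral_eq_integral)
  also have "\<dots> = integral {0..1} ?e"
    by (rule integral_spike[OF neg]) (use spike in auto)
  finally show "Ep p v = integral {0..1} ?e" .
  show "?e integrable_on {0..1}" using ei by (rule set_lebesgue_integral_eq_integral)
qed

lemma W2p_energyE:
  assumes v: "W2p p v" and p: "p > 1"
  obtains u1 g where
    "g absolutely_integrable_on {0..1}"
    "continuous_on {0..1} u1"
    "\<And>x. x \<in> {0..1} \<Longrightarrow> u1 x = u1 0 + integral {0..x} g"
    "\<And>x. x \<in> {0..1} \<Longrightarrow> v x = v 0 + integral {0..x} u1"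
    "(\<lambda>x. \<bar>elastic_weight p (u1 x) * g x\<bar> powr p) integrable_on {0..1}"
    "Ep p v = integral {0..1} (\<lambda>x. \<bar>elastic_weight p (u1 x) * g x\<bar> powr p)"
proof -
  obtain u1 g where g: "g absolutely_integrable_on {0..1}"
    and gp: "(\<lambda>x. \<bar>g x\<bar> powr p) absolutely_integrable_on {0..1}"
    and cu: "continuous_on {0..1} u1"
    and u1: "\<And>x. x \<in> {0..1} \<Longrightarrow> u1 x = u1 0 + (LINT t:{0..x}|lebesgue. g t)"
    and vx: "\<And>x. x \<in> {0..1} \<Longrightarrow> v x = v 0 + (LINT t:{0..x}|lebesgue. u1 t)"
    using v unfolding W2p_def by blast
  have u1': "u1 x = u1 0 + integral {0..x} g" if "x \<in> {0..1}" for x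
    using u1[OF that] that absolutely_integrable_on_subinterval[OF g, of 0 x]
    by (simp add: set_lebesgue_integral_eq_integral)
  have vx': "v x = v 0 + integral {0..x} u1" if "x \<in> {0..1}" for x
    using vx[OF that] that absolutely_integrable_on_subinterval[OF absolutely_integrable_continuous_real[OF cu], of 0 x]
    by (simp add: set_lebesgue_integral_eq_integral)
  show ?thesis
    by (rule that[OF g cu u1' vx' Ep_eq_integral[OF p g gp cu u1' vx']])
qed

section \<open>Arcs of the free p-elastica\<close>

text \<open>This is |\<kappa>|^(p - 1) on the elastica with |\<kappa>|^p = sin \<phi>. The absolute
  value makes it continuous on the whole line.\<close>

definition sin_pow :: "real \<Rightarrow> real \<Rightarrow> real" where
  "sin_pow p \<phi> = \<bar>sin \<phi>\<bar> powr (1 - 1 / p)"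

text \<open>A primitive of \<^const>\<open>sin_pow\<close>; the lower limit \<open>-pi\<close> makes it one on a neighbourhood of the
  range \<open>[0, pi)\<close> of the angles that occur.\<close>

definition sin_int :: "real \<Rightarrow> real \<Rightarrow> real" where
  "sin_int p \<phi> = integral {- pi..\<phi>} (sin_pow p) - integral {- pi..0} (sin_pow p)"

text \<open>Width and height of the arc of the free p-elastica along which the tangent angle decreases
  from \<open>\<alpha>\<close> (at an inflection point) to \<open>0\<close>, in the scale with \<open>|\<kappa>| = sin (\<alpha> - \<theta>) powr (1/p)\<close>.\<close>

definition arc_width :: "real \<Rightarrow> real \<Rightarrow> real" where
  "arc_width p \<alpha> = p / (p - 1) * sin_pow p \<alpha> * cos \<alpha> + sin_int p \<alpha> * sin \<alpha>"

definition arc_height :: "real \<Rightarrow> real \<Rightarrow> real" where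
  "arc_height p \<alpha> = p / (p - 1) * sin_pow p \<alpha> * sin \<alpha> - sin_int p \<alpha> * cos \<alpha>"

text \<open>The value of \<open>\<integral> (sin \<alpha> - u' cos \<alpha>) dx\<close> over \<open>[0, 1/2]\<close> when \<open>u 0 = 0\<close> and \<open>u (1/2) = h\<close>.\<close>

definition tilt :: "real \<Rightarrow> real \<Rightarrow> real" where
  "tilt h \<alpha> = sin \<alpha> / 2 - h * cos \<alpha>"

text \<open>The function \<open>J\<close>: the lower bound for the energy of one half.\<close>

definition arc_energy :: "real \<Rightarrow> real \<Rightarrow> real \<Rightarrow> real" where
  "arc_energy p h \<alpha> = sin_int p \<alpha> powr p / tilt h \<alpha> powr (p - 1)"

locale elastic_exponent =
  fixes p :: real
  assumes p_gt_1: "p > 1"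
begin

lemma continuous_sin_pow: "continuous_on S (sin_pow p)"
  unfolding sin_pow_def using p_gt_1
  by (intro continuous_on_powr' continuous_intros) auto

lemma sin_pow_nonneg: "sin_pow p \<phi> \<ge> 0"
  by (simp add: sin_pow_def)

lemma sin_int_deriv:
  assumes "\<phi> > - pi"
  shows "(sin_int p has_real_derivative sin_pow p \<phi>) (at \<phi>)"
proof -
  have "((\<lambda>x. integral {- pi..x} (sin_pow p)) has_real_derivative sin_pow p \<phi>) (at \<phi> within {- pi..\<phi> + 1})"
    using assms by (intro integral_has_real_derivative continuous_sin_pow) auto
  then have "((\<lambda>x. integral {- pi..x} (sin_pow p)) has_real_derivative sin_pow p \<phi>) (at \<phi>)"
    using assms by (simp add: at_within_Icc_at)
  then have "((\<lambda>x. integral {- pi..x} (sin_pow p) - integral {- pi..0} (sin_pow p)) has_real_derivative sin_pow p \<phi> - 0) (at \<phi>)"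
    by (intro DERIV_diff DERIV_const)
  then show ?thesis by (simp add: sin_int_def[abs_def])
qed

lemma sin_int_0 [simp]: "sin_int p 0 = 0"
  by (simp add: sin_int_def)

lemma continuous_sin_int: "S \<subseteq> {- pi<..} \<Longrightarrow> continuous_on S (sin_int p)"
  by (rule continuous_at_imp_continuous_on) (meson DERIV_isCont greaterThan_iff sin_int_deriv subsetD)

lemma sin_int_strict_mono:
  assumes "0 \<le> a" "a < b" "b \<le> pi"
  shows "sin_int p a < sin_int p b"
proof (rule DERIV_pos_imp_increasing_open[OF assms(2)])
  fix x assume x: "a < x" "x < b"
  then have "sin x > 0" using assms by (intro sin_gt_zero) auto
  then have "sin_pow p x > 0" by (simp add: sin_pow_def)
  then show "\<exists>y. (sin_int p has_real_derivative y) (at x) \<and> y > 0"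
    using sin_int_deriv[of x] x assms pi_gt_zero by (metis less_trans neg_less_0_iff_less order_le_less_trans)
qed (use assms pi_gt_zero in \<open>auto intro!: continuous_sin_int\<close>)

lemma sin_int_pos: "0 < a \<Longrightarrow> a \<le> pi \<Longrightarrow> sin_int p a > 0"
  using sin_int_strict_mono[of 0 a] by simp

text \<open>With \<phi> = \<alpha> - \<theta> and |\<kappa>| = (sin \<phi>)^(1/p), arc length
  satisfies ds = (sin \<phi>)^(-1/p) d\<phi>. The derivative is therefore cos \<phi> ds/d\<phi>: the
  function measures displacement along the tangent at the inflection point, while
  \<open>sin_int\<close> measures displacement across it.\<close>

lemma sin_pow_deriv:
  assumes "0 < \<phi>" "\<phi> < pi"
  shows "((\<lambda>\<phi>. p / (p - 1) * sin_pow p \<phi>) has_real_derivative cos \<phi> * sin \<phi> powr (- (1 / p))) (at \<phi>)"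
proof -
  have s: "sin \<phi> > 0" using assms by (simp add: sin_gt_zero)
  have "((\<lambda>\<phi>. p / (p - 1) * sin \<phi> powr (1 - 1 / p)) has_real_derivative
      p / (p - 1) * ((1 - 1 / p) * sin \<phi> powr (1 - 1 / p - 1) * cos \<phi>)) (at \<phi>)"
    using DERIV_cmult[OF DERIV_fun_powr[OF DERIV_sin s, of "1 - 1 / p"], of "p / (p - 1)"] by simp
  moreover have "p / (p - 1) * ((1 - 1 / p) * sin \<phi> powr (1 - 1 / p - 1) * cos \<phi>) = cos \<phi> * sin \<phi> powr (- (1 / p))"
    using p_gt_1 by (simp add: field_simps)
  ultimately have "((\<lambda>\<phi>. p / (p - 1) * sin \<phi> powr (1 - 1 / p)) has_real_derivative
      cos \<phi> * sin \<phi> powr (- (1 / p))) (at \<phi>)" by simp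
  then show ?thesis
    by (rule has_field_derivative_transform_within_open[where S="{0<..<pi}"])
       (use assms in \<open>auto simp: sin_pow_def abs_of_pos sin_gt_zero\<close>)
qed

lemma sin_pow_eq:
  assumes "0 < \<phi>" "\<phi> < pi"
  shows "sin_pow p \<phi> = sin \<phi> * sin \<phi> powr (- (1 / p))"
proof -
  have s: "sin \<phi> > 0" using assms by (simp add: sin_gt_zero)
  then have "sin_pow p \<phi> = sin \<phi> powr (1 + - (1 / p))" by (simp add: sin_pow_def)
  also have "\<dots> = sin \<phi> powr 1 * sin \<phi> powr (- (1 / p))" by (rule powr_add)
  finally show ?thesis using s by simp
qed

text \<open>Width and height are the displacements along and across the initial tangent, turned by
  \<alpha> into horizontal and vertical coordinates; these identities undo the rotation.\<close>

lemma arc_rotate: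
  "arc_width p \<alpha> * sin \<alpha> - arc_height p \<alpha> * cos \<alpha> = sin_int p \<alpha>"
  "arc_width p \<alpha> * cos \<alpha> + arc_height p \<alpha> * sin \<alpha> = p / (p - 1) * sin_pow p \<alpha>"
proof -
  have *: "A * (cos \<alpha> * cos \<alpha>) + A * (sin \<alpha> * sin \<alpha>) = A" for A
    using sin_cos_squared_add3[of \<alpha>] by (simp add: distrib_left[symmetric])
  have "arc_width p \<alpha> * sin \<alpha> - arc_height p \<alpha> * cos \<alpha> =
      sin_int p \<alpha> * (cos \<alpha> * cos \<alpha>) + sin_int p \<alpha> * (sin \<alpha> * sin \<alpha>)"
    by (simp add: arc_width_def arc_height_def algebra_simps)
  then show "arc_width p \<alpha> * sin \<alpha> - arc_height p \<alpha> * cos \<alpha> = sin_int p \<alpha>" by (simp only: *)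
  have "arc_width p \<alpha> * cos \<alpha> + arc_height p \<alpha> * sin \<alpha> =
      (p / (p - 1) * sin_pow p \<alpha>) * (cos \<alpha> * cos \<alpha>) + (p / (p - 1) * sin_pow p \<alpha>) * (sin \<alpha> * sin \<alpha>)"
    unfolding arc_width_def arc_height_def by (simp only: algebra_simps)
  then show "arc_width p \<alpha> * cos \<alpha> + arc_height p \<alpha> * sin \<alpha> = p / (p - 1) * sin_pow p \<alpha>" by (simp only: *)
qed

text \<open>Raising \<alpha> rotates the whole arc, which contributes (-Y, X), and prolongs it at
  its horizontal end, which contributes the length (sin \<alpha>)^(-1/p) to the width alone.\<close>

lemma arc_deriv:
  assumes "0 < \<alpha>" "\<alpha> < pi"
  shows "(arc_width p has_real_derivative sin \<alpha> powr (- (1 / p)) - arc_height p \<alpha>) (at \<alpha>)"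
    and "(arc_height p has_real_derivative arc_width p \<alpha>) (at \<alpha>)"
proof -
  let ?q = "sin \<alpha> powr (- (1 / p))"
  note S = sin_pow_deriv[OF assms] and B = sin_int_deriv[of \<alpha>]
  have pi: "\<alpha> > - pi" using assms pi_gt_zero by linarith
  have "((\<lambda>\<alpha>. p / (p - 1) * sin_pow p \<alpha> * cos \<alpha> + sin_int p \<alpha> * sin \<alpha>) has_real_derivative
     (cos \<alpha> * ?q * cos \<alpha> + - sin \<alpha> * (p / (p - 1) * sin_pow p \<alpha>)) + (sin_pow p \<alpha> * sin \<alpha> + cos \<alpha> * sin_int p \<alpha>)) (at \<alpha>)"
    by (intro DERIV_add DERIV_mult S B[OF pi] DERIV_sin DERIV_cos)
  moreover have "(cos \<alpha> * ?q * cos \<alpha> + - sin \<alpha> * (p / (p - 1) * sin_pow p \<alpha>)) + (sin_pow p \<alpha> * sin \<alpha> + cos \<alpha> * sin_int p \<alpha>)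
     = (sin \<alpha> * sin \<alpha> + cos \<alpha> * cos \<alpha>) * ?q - arc_height p \<alpha>"
  proof -
    have "(c * q * c + - s * A) + (s * q * s + c * B) = (s * s + c * c) * q - (A * s - B * c)" for s c q A B :: real
      by (simp add: algebra_simps)
    then show ?thesis unfolding arc_height_def by (subst (2) sin_pow_eq[OF assms])
  qed
  moreover have "sin \<alpha> * sin \<alpha> + cos \<alpha> * cos \<alpha> = 1"
    by (metis power2_eq_square sin_cos_squared_add)
  ultimately show "(arc_width p has_real_derivative ?q - arc_height p \<alpha>) (at \<alpha>)"
    by (simp add: arc_width_def[abs_def])
  have "((\<lambda>\<alpha>. p / (p - 1) * sin_pow p \<alpha> * sin \<alpha> - sin_int p \<alpha> * cos \<alpha>) has_real_derivative
     (cos \<alpha> * ?q * sin \<alpha> + cos \<alpha> * (p / (p - 1) * sin_pow p \<alpha>)) - (sin_pow p \<alpha> * cos \<alpha> + - sin \<alpha> * sin_int p \<alpha>)) (at \<alpha>)"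
    by (intro DERIV_diff DERIV_mult S B[OF pi] DERIV_sin DERIV_cos)
  moreover have "(cos \<alpha> * ?q * sin \<alpha> + cos \<alpha> * (p / (p - 1) * sin_pow p \<alpha>)) - (sin_pow p \<alpha> * cos \<alpha> + - sin \<alpha> * sin_int p \<alpha>)
     = arc_width p \<alpha>"
    unfolding arc_width_def by (subst (2) sin_pow_eq[OF assms]) (simp add: algebra_simps)
  ultimately show "(arc_height p has_real_derivative arc_width p \<alpha>) (at \<alpha>)"
    by (simp add: arc_height_def[abs_def])
qed

lemma arc_width_pos:
  assumes "0 < \<alpha>" "\<alpha> \<le> pi / 2"
  shows "arc_width p \<alpha> > 0"
proof -
  have "sin \<alpha> > 0" "cos \<alpha> \<ge> 0" "sin_int p \<alpha> > 0"
    using assms pi_gt_zero by (auto intro!: sin_gt_zero cos_ge_zero sin_int_pos)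
  then show ?thesis unfolding arc_width_def using p_gt_1
    by (intro add_nonneg_pos mult_nonneg_nonneg mult_pos_pos sin_pow_nonneg) auto
qed

text \<open>With q = (sin x)^(-1/p), the numerator of the derivative is X^2 + Y^2 - qY. The rotation
  turns X^2 + Y^2 into A^2 + B^2, and qY < A^2 because Y \<le> A sin x and q sin x = A (p -
  1)/p.\<close>

lemma arc_ratio_strict_mono:
  assumes "0 < \<alpha>" "\<alpha> < \<beta>" "\<beta> \<le> pi / 2"
  shows "arc_height p \<alpha> / arc_width p \<alpha> < arc_height p \<beta> / arc_width p \<beta>"
proof (rule DERIV_pos_imp_increasing[OF assms(2)])
  fix x assume x: "\<alpha> \<le> x" "x \<le> \<beta>"
  have x0: "0 < x" "x < pi" "x \<le> pi / 2" using x assms pi_gt_zero by auto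
  let ?X = "arc_width p x" and ?Y = "arc_height p x" and ?q = "sin x powr (- (1 / p))"
  define A where "A = p / (p - 1) * sin_pow p x"
  define B where "B = sin_int p x"
  have X: "?X > 0" using arc_width_pos x0 by simp
  have s: "sin x > 0" "cos x \<ge> 0" using x0 by (auto intro: sin_gt_zero cos_ge_zero)
  have B: "B > 0" using sin_int_pos x0 by (simp add: B_def)
  have q: "?q > 0" using s by simp
  have A: "A > 0" using s q p_gt_1 by (simp add: A_def sin_pow_eq[OF x0(1,2)])
  have Aq: "(sin x * ?q) * p = A * (p - 1)"
    using p_gt_1 by (simp add: A_def sin_pow_eq[OF x0(1,2)])
  have Y: "?Y = A * sin x - B * cos x" by (simp add: arc_height_def A_def B_def)
  have XX: "?X = A * cos x + B * sin x" by (simp add: arc_width_def A_def B_def)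
  have "?X\<^sup>2 + ?Y\<^sup>2 = (A\<^sup>2 + B\<^sup>2) * ((sin x)\<^sup>2 + (cos x)\<^sup>2)"
  proof -
    have "(A * c + B * s)\<^sup>2 + (A * s - B * c)\<^sup>2 = (A\<^sup>2 + B\<^sup>2) * (s\<^sup>2 + c\<^sup>2)" for s c :: real
      by (simp add: power2_eq_square algebra_simps)
    then show ?thesis unfolding Y XX .
  qed
  then have XY: "?X\<^sup>2 + ?Y\<^sup>2 = A\<^sup>2 + B\<^sup>2" by simp
  have "?Y * ?q \<le> A * (sin x * ?q)"
    using B s q unfolding Y by (simp add: algebra_simps)
  also have "\<dots> < A * A"
  proof -
    have "sin x * ?q < A"
    proof (rule ccontr)
      assume "\<not> sin x * ?q < A"
      then have "A * p \<le> A * (p - 1)" using Aq p_gt_1 by (metis mult_right_mono not_le less_imp_le less_trans zero_less_one)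
      then show False using A p_gt_1 by simp
    qed
    then show ?thesis using A by simp
  qed
  finally have pos: "?X\<^sup>2 + ?Y\<^sup>2 - ?Y * ?q > 0" using XY mult_pos_pos[OF B B] by (simp add: power2_eq_square)
  have "((\<lambda>x. arc_height p x / arc_width p x) has_real_derivative
     (?X * ?X - ?Y * (?q - ?Y)) / (?X * ?X)) (at x)"
    using X by (intro DERIV_divide arc_deriv[OF x0(1,2)]) auto
  moreover have "(?X * ?X - ?Y * (?q - ?Y)) / (?X * ?X) > 0"
    using pos X by (intro divide_pos_pos) (auto simp: power2_eq_square algebra_simps)
  ultimately show "\<exists>y. ((\<lambda>x. arc_height p x / arc_width p x) has_real_derivative y) (at x) \<and> y > 0" by blast
qed

section \<open>Monotonicity and minimum of the bounding function \<open>arc_energy\<close>\<close>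

lemma tilt_strict_mono:
  assumes "h > 0" "0 \<le> a" "a < b" "b \<le> pi / 2"
  shows "tilt h a < tilt h b"
proof -
  have "sin a < sin b" using assms by (intro sin_monotone_2pi) auto
  moreover have "cos b < cos a" using assms pi_gt_zero by (intro cos_monotone_0_pi) auto
  ultimately show ?thesis using assms(1) unfolding tilt_def
    by (smt (verit) divide_strict_right_mono mult_strict_left_mono)
qed

lemma arc_energy_pos:
  assumes "0 < a" "a \<le> pi / 2" "tilt h a > 0"
  shows "arc_energy p h a > 0"
  using assms sin_int_pos[of a] pi_gt_zero by (simp add: arc_energy_def)

text \<open>The logarithm turns the quotient of powers into a difference; over the common
  denominator the trigonometric terms regroup into the width and height of the arc.\<close>

lemma ln_arc_energy_deriv:
  assumes a: "0 < a" "a < pi / 2" and t: "tilt h a > 0"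
  shows "((\<lambda>a. p * ln (sin_int p a) - (p - 1) * ln (tilt h a)) has_real_derivative
     (p - 1) * (arc_height p a / 2 - h * arc_width p a) / (sin_int p a * tilt h a)) (at a)"
proof -
  have B: "sin_int p a > 0" using a sin_int_pos[of a] pi_gt_zero by auto
  have "(tilt h has_real_derivative cos a / 2 + h * sin a) (at a)"
    unfolding tilt_def[abs_def] by (auto intro!: derivative_eq_intros)
  then have "((\<lambda>a. p * ln (sin_int p a) - (p - 1) * ln (tilt h a)) has_real_derivative
     p * (1 / sin_int p a * sin_pow p a) - (p - 1) * (1 / tilt h a * (cos a / 2 + h * sin a))) (at a)"
    using a B t pi_gt_zero
    by (intro DERIV_diff DERIV_cmult  sin_int_deriv DERIV_chain2[OF DERIV_ln_divide]) auto
  moreover have "p * (1 / sin_int p a * sin_pow p a) - (p - 1) * (1 / tilt h a * (cos a / 2 + h * sin a))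
     = (p - 1) * (arc_height p a / 2 - h * arc_width p a) / (sin_int p a * tilt h a)"
  proof -
    define A where "A = p / (p - 1) * sin_pow p a"
    have A: "p * sin_pow p a = (p - 1) * A" using p_gt_1 by (simp add: A_def)
    have "p * (1 / sin_int p a * sin_pow p a) - (p - 1) * (1 / tilt h a * (cos a / 2 + h * sin a))
      = (p - 1) * (A * tilt h a - sin_int p a * (cos a / 2 + h * sin a)) / (sin_int p a * tilt h a)"
    proof -
      have "p * (1 / sin_int p a * sin_pow p a) = (p - 1) * A / sin_int p a" using A by simp
      then show ?thesis using B t by (simp only:) (simp add: field_simps)
    qed
    also have "A * tilt h a - sin_int p a * (cos a / 2 + h * sin a) = arc_height p a / 2 - h * arc_width p a"
      by (simp only: tilt_def arc_height_def arc_width_def A_def[symmetric]) (simp add: field_simps)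
    finally show ?thesis .
  qed
  ultimately show ?thesis by simp
qed

lemma ln_arc_energy:
  assumes "0 < a" "a \<le> pi / 2" "tilt h a > 0"
  shows "ln (arc_energy p h a) = p * ln (sin_int p a) - (p - 1) * ln (tilt h a)"
  using assms sin_int_pos[of a] pi_gt_zero by (simp add: arc_energy_def ln_div ln_powr)

text \<open>The ratio is compared with 2h only strictly between a and b, so either end may be the
  critical angle and b may be pi/2.\<close>

lemma arc_energy_less:
  assumes h: "h > 0" and ab: "0 < a" "a < b" "b \<le> pi / 2" and t: "tilt h a > 0"
  shows arc_energy_less_left:
      "(\<And>x. a < x \<Longrightarrow> x < b \<Longrightarrow> arc_height p x / arc_width p x < 2 * h) \<Longrightarrow> arc_energy p h b < arc_energy p h a"
    and arc_energy_less_right: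
      "(\<And>x. a < x \<Longrightarrow> x < b \<Longrightarrow> arc_height p x / arc_width p x > 2 * h) \<Longrightarrow> arc_energy p h a < arc_energy p h b"
proof -
  let ?L = "\<lambda>a. p * ln (sin_int p a) - (p - 1) * ln (tilt h a)"
  have tx: "tilt h x > 0" if "a \<le> x" "x \<le> b" for x
    using tilt_strict_mono[OF h, of a x] that ab t by (cases "x = a") auto
  have Bx: "sin_int p x > 0" if "a \<le> x" "x \<le> b" for x
    using that ab pi_gt_zero by (intro sin_int_pos) auto
  have sub: "{a..b} \<subseteq> {- pi<..}" using ab pi_gt_zero by auto
  have "continuous_on {a..b} (tilt h)"
    unfolding tilt_def by (intro continuous_intros) auto
  then have cont: "continuous_on {a..b} ?L"
    using tx Bx continuous_sin_int[OF sub] by (intro continuous_intros) (auto simp: less_imp_neq[symmetric])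
  have J: "arc_energy p h a > 0" "arc_energy p h b > 0"
    using ab t tx[of b] by (auto intro!: arc_energy_pos)
  have L: "ln (arc_energy p h a) = ?L a" "ln (arc_energy p h b) = ?L b"
    using ab t tx[of b] by (auto intro!: ln_arc_energy)
  have D: "(?L has_real_derivative (p - 1) * (arc_height p x / 2 - h * arc_width p x) / (sin_int p x * tilt h x)) (at x)"
    "sin_int p x * tilt h x > 0" "arc_width p x > 0"
    if "a < x" "x < b" for x
    using that ab tx[of x] Bx[of x] by (auto intro!: ln_arc_energy_deriv arc_width_pos)
  show "arc_energy p h b < arc_energy p h a"
    if r: "\<And>x. a < x \<Longrightarrow> x < b \<Longrightarrow> arc_height p x / arc_width p x < 2 * h"
  proof -
    have "?L b < ?L a"
    proof (rule DERIV_neg_imp_decreasing_open[OF ab(2) _ cont])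
      fix x assume x: "a < x" "x < b"
      have "arc_height p x / 2 - h * arc_width p x < 0"
        using r[OF x] D(3)[OF x] by (simp add: field_simps)
      then have "(p - 1) * (arc_height p x / 2 - h * arc_width p x) / (sin_int p x * tilt h x) < 0"
        using p_gt_1 D(2)[OF x] by (intro divide_neg_pos mult_pos_neg) auto
      with D(1)[OF x] show "\<exists>y. (?L has_real_derivative y) (at x) \<and> y < 0" by blast
    qed
    then show ?thesis using L J by (metis ln_less_cancel_iff)
  qed
  show "arc_energy p h a < arc_energy p h b"
    if r: "\<And>x. a < x \<Longrightarrow> x < b \<Longrightarrow> arc_height p x / arc_width p x > 2 * h"
  proof -
    have "?L a < ?L b"
    proof (rule DERIV_pos_imp_increasing_open[OF ab(2) _ cont])
      fix x assume x: "a < x" "x < b"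
      have "arc_height p x / 2 - h * arc_width p x > 0"
        using r[OF x] D(3)[OF x] by (simp add: field_simps)
      then have "(p - 1) * (arc_height p x / 2 - h * arc_width p x) / (sin_int p x * tilt h x) > 0"
        using p_gt_1 D(2)[OF x] by (intro divide_pos_pos[OF mult_pos_pos]) auto
      with D(1)[OF x] show "\<exists>y. (?L has_real_derivative y) (at x) \<and> y > 0" by blast
    qed
    then show ?thesis using L J by (metis ln_less_cancel_iff)
  qed
qed

lemma arc_energy_unique_min:
  assumes h: "h > 0" and b: "0 < b" "b < pi / 2" "arc_height p b / arc_width p b = 2 * h"
    and a: "0 < a" "a < pi / 2" "tilt h a > 0" "a \<noteq> b"
  shows "arc_energy p h b < arc_energy p h a"
proof (cases "a < b")
  case True
  show ?thesis
    by (rule arc_energy_less_left[OF h a(1) True _ a(3)])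
       (use a b arc_ratio_strict_mono[of _ b] in auto)
next
  case False
  then have ba: "b < a" using a by simp
  \<comment> \<open>At the critical angle, \<open>arc_rotate\<close> gives tilt =
    \<open>sin_int p b / (2 * arc_width p b)\<close>.\<close>
  have "tilt h b > 0"
  proof -
    have "arc_width p b * tilt h b * 2 = sin_int p b"
      using arc_rotate(1)[of b] b(3) arc_width_pos[of b] b by (simp add: tilt_def field_simps)
    moreover have "sin_int p b > 0" using sin_int_pos[of b] b by simp
    ultimately show ?thesis using arc_width_pos[of b] b by (metis less_imp_le zero_less_mult_pos zero_less_mult_pos2 zero_less_numeral)
  qed
  then show ?thesis
    by (intro arc_energy_less_right[OF h b(1) ba])
       (use a b arc_ratio_strict_mono[of b] in auto)
qed

text \<open>Height of the arc with vertical initial tangent once it is rescaled to the width 1/2 of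
  half the interval.\<close>

definition critical_height :: real where
  "critical_height = arc_height p (pi / 2) / arc_width p (pi / 2) / 2"

lemma critical_height_pos: "critical_height > 0"
  using p_gt_1 arc_width_pos[of "pi / 2"] pi_gt_zero
  by (simp add: critical_height_def arc_height_def sin_pow_def)

lemma critical_angle_exists:
  assumes "0 < h" "h < critical_height"
  shows "\<exists>b. 0 < b \<and> b < pi / 2 \<and> arc_height p b / arc_width p b = 2 * h"
proof -
  let ?r = "\<lambda>b. arc_height p b / arc_width p b"
  \<comment> \<open>Starting the intermediate value argument here avoids the limit at angle 0, where
    the width vanishes: the arc stays below its initial tangent, so its ratio is less than tan a =
    2h.\<close>
  define a where "a = arctan (2 * h)"
  have a: "0 < a" "a < pi / 2" using assms arctan_ubound by (auto simp: a_def zero_less_arctan_iff)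
  have c: "cos a > 0" using a by (intro cos_gt_zero) auto
  have "arc_height p a * cos a < arc_width p a * sin a"
    using arc_rotate(1)[of a] sin_int_pos[of a] a by simp
  then have "?r a < sin a / cos a"
    using c arc_width_pos[of a] a by (simp add: field_simps)
  also have "sin a / cos a = 2 * h" 
    using tan_arctan[of "2 * h"] by (simp add: a_def tan_def)
  finally have ra: "?r a < 2 * h" .
  have rb: "2 * h < ?r (pi / 2)" using assms by (simp add: critical_height_def)
  have "isCont ?r x" if "a \<le> x" "x \<le> pi / 2" for x
    using that a arc_deriv[of x, THEN DERIV_isCont] arc_width_pos[of x] pi_gt_zero
    by (intro continuous_intros) auto
  then have "\<exists>x\<ge>a. x \<le> pi / 2 \<and> ?r x = 2 * h"
    using ra rb a by (intro IVT) auto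
  then obtain b where b: "a \<le> b" "b \<le> pi / 2" "?r b = 2 * h" by blast
  then have "b \<noteq> pi / 2" using rb by (metis less_irrefl)
  with b a show ?thesis by (intro exI[of _ b]) auto
qed

text \<open>Past pi/2 the derivative \<open>sin_pow\<close> decreases, so full convexity fails.
  Moving symmetrically away from a midpoint m < pi/2 still suffices: sin (m + s) - sin (m - s) = 2
  cos m sin s is nonnegative.\<close>

lemma sin_int_midpoint_convex:
  assumes "0 \<le> a" "0 \<le> b" "a + b < pi"
  shows "2 * sin_int p ((a + b) / 2) \<le> sin_int p a + sin_int p b"
  using assms
proof (induction a b rule: linorder_wlog)
  case (sym a b) then show ?case by (simp add: add.commute)
next
  case (le a b)
  define m where "m = (a + b) / 2"
  define d where "d = (b - a) / 2"
  have m: "0 \<le> m" "m < pi / 2" and d: "0 \<le> d" "d \<le> m" using le by (auto simp: m_def d_def)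
  have "sin_int p (m + 0) + sin_int p (m - 0) \<le> sin_int p (m + d) + sin_int p (m - d)"
  proof (rule DERIV_nonneg_imp_nondecreasing[OF d(1)])
    fix s assume s: "0 \<le> s" "s \<le> d"
    have "((\<lambda>s. sin_int p (m + s) + sin_int p (m - s)) has_real_derivative
        sin_pow p (m + s) * 1 + sin_pow p (m - s) * (- 1)) (at s)"
      by (rule DERIV_add; rule DERIV_chain2[OF sin_int_deriv])
         (use s m d pi_gt_zero in \<open>auto intro!: derivative_eq_intros\<close>)
    moreover have "sin_pow p (m - s) \<le> sin_pow p (m + s)"
    proof -
      have "0 \<le> sin (m - s)" "0 \<le> sin (m + s)" "0 \<le> cos m" "0 \<le> sin s"
        using s m d by (auto intro!: sin_ge_zero cos_ge_zero)
      moreover have "sin (m + s) - sin (m - s) = 2 * (cos m * sin s)"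
        by (simp add: sin_add sin_diff)
      ultimately have "\<bar>sin (m - s)\<bar> \<le> \<bar>sin (m + s)\<bar>"
        by (smt (verit) mult_nonneg_nonneg)
      then show ?thesis unfolding sin_pow_def using p_gt_1 by (intro powr_mono2) auto
    qed
    ultimately show "\<exists>y. ((\<lambda>s. sin_int p (m + s) + sin_int p (m - s)) has_real_derivative y) (at s) \<and> y \<ge> 0"
      by force
  qed
  moreover have "m + d = b" "m - d = a" by (auto simp: m_def d_def field_simps)
  ultimately show ?case by (simp add: m_def)
qed

text \<open>Sum-to-product formulas; since the cosine factor is at most 1, a nonnegative tilt at the
  mean angle dominates the average of the two tilts.\<close>

lemma tilt_add: "tilt h a + tilt h b = 2 * cos ((a - b) / 2) * tilt h ((a + b) / 2)"
proof -
  have "sin a + sin b = 2 * sin ((a + b) / 2) * cos ((a - b) / 2)" by (rule sin_plus_sin)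
  moreover have "cos a + cos b = 2 * cos ((a + b) / 2) * cos ((a - b) / 2)" by (rule cos_plus_cos)
  moreover have "tilt h a + tilt h b = (sin a + sin b) / 2 - h * (cos a + cos b)"
    by (simp add: tilt_def field_simps)
  ultimately show ?thesis by (simp add: tilt_def algebra_simps)
qed

lemma scale_value:
  assumes b: "b > 0" and f: "f > 0"
  shows "p * (b / f) powr (p - 1) * b - (p - 1) * (b / f) powr p * f = b powr p / f powr (p - 1)"
proof -
  define t where "t = b / f"
  have "t powr p * f = t powr (p - 1) * b"
  proof -
    have "t powr p = t powr (p - 1) * t powr 1" by (simp only: powr_add[symmetric]) simp
    then show ?thesis using b f by (simp add: t_def)
  qed
  moreover have "t powr (p - 1) * b = b powr p / f powr (p - 1)"
  proof -
    have "b powr p = b powr (p - 1) * b powr 1" by (simp only: powr_add[symmetric]) simp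
    then show ?thesis using b f by (simp add: t_def powr_divide)
  qed
  moreover have "p * t powr (p - 1) * b - (p - 1) * t powr p * f = p * (t powr (p - 1) * b) - (p - 1) * (t powr p * f)"
    by (simp add: mult.assoc)
  ultimately show ?thesis unfolding t_def[symmetric] by (simp add: left_diff_distrib diff_divide_distrib)
qed

text \<open>The bound is evaluated at its maximizer t = b/f. If f vanished, only the term in t^(p -
  1) would remain, which is unbounded in t; this is how a nonnegative tilt becomes positive.\<close>

lemma optimal_scale:
  assumes E: "\<And>t. t > 0 \<Longrightarrow> p * t powr (p - 1) * b - (p - 1) * t powr p * f \<le> E"
    and b: "b > 0" and f: "f \<ge> 0"
  shows "f > 0" and "b powr p / f powr (p - 1) \<le> E"
proof -
  show f0: "f > 0"
  proof (rule ccontr)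
    assume "\<not> f > 0"
    then have "f = 0" using f by simp
    \<comment> \<open>Solves p t^(p - 1) b = |E| + 1, which exceeds the supposed bound E.\<close>
    define t where "t = ((\<bar>E\<bar> + 1) / (p * b)) powr (1 / (p - 1))"
    have q: "(\<bar>E\<bar> + 1) / (p * b) > 0" using b p_gt_1 by (intro divide_pos_pos) auto
    then have "t > 0" unfolding t_def by (metis powr_gt_zero less_irrefl)
    moreover have "t powr (p - 1) = (\<bar>E\<bar> + 1) / (p * b)"
    proof -
      have "1 / (p - 1) * (p - 1) = 1" using p_gt_1 by simp
      then show ?thesis by (simp only: t_def powr_powr powr_one[OF less_imp_le[OF q]])
    qed
    ultimately have "\<bar>E\<bar> + 1 \<le> E" using E[of t] \<open>f = 0\<close> b p_gt_1 by simp
    then show False by simp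
  qed
  show "b powr p / f powr (p - 1) \<le> E"
    using E[of "b / f"] scale_value[OF b f0] b f0 by simp
qed

end

section \<open>The energy of one half\<close>

text \<open>Young's inequality written as the tangent line of the convex function |y|^p. Strictness
  away from the contact point is what later forces the elastica equation.\<close>

lemma powr_tangent:
  fixes p s y :: real
  assumes p: "p > 1" and s: "s \<ge> 0"
  shows "p * s powr (p - 1) * y - (p - 1) * s powr p \<le> \<bar>y\<bar> powr p"
    and "y \<noteq> s \<Longrightarrow> p * s powr (p - 1) * y - (p - 1) * s powr p < \<bar>y\<bar> powr p"
proof -
  have sp: "s powr p = s powr (p - 1) * s"
  proof -
    have "s powr p = s powr (p - 1) * s powr 1" by (simp only: powr_add[symmetric]) simp
    then show ?thesis using s by simp
  qed
  show *: "p * s powr (p - 1) * y - (p - 1) * s powr p < \<bar>y\<bar> powr p" if ne: "y \<noteq> s"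
  proof (cases "y \<le> 0")
    case True
    have 1: "p * s powr (p - 1) * y \<le> 0" using True p by (intro mult_nonneg_nonpos) auto
    have 2: "(p - 1) * s powr p \<ge> 0" using p by simp
    have 3: "\<bar>y\<bar> powr p \<ge> 0" by simp
    show ?thesis
    proof (cases "s = 0")
      case True
      then have "\<bar>y\<bar> powr p > 0" using ne by simp
      then show ?thesis using 1 2 by linarith
    next
      case False
      then have "(p - 1) * s powr p > 0" using p by simp
      then show ?thesis using 1 3 by linarith
    qed
  next
    case False
    then have y: "y > 0" by simp
    show ?thesis
    proof (cases "s = 0")
      case True then show ?thesis using y by simp
    next
      case False
      then have s0: "s > 0" using s by simp
      have D: "((\<lambda>x. x powr p) has_real_derivative p * x powr (p - 1)) (at x)" if "x > 0" for x
        using that by (rule has_real_derivative_powr)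
      consider "s < y" | "y < s" using ne by linarith
      then show ?thesis
      proof cases
        case 1
        obtain z where z: "s < z" "z < y" "y powr p - s powr p = (y - s) * (p * z powr (p - 1))"
          using MVT2[OF 1, of "\<lambda>x. x powr p" "\<lambda>x. p * x powr (p - 1)"] D s0 by force
        have "s powr (p - 1) < z powr (p - 1)" using z s0 p by (intro powr_less_mono2) auto
        then have "(y - s) * (p * s powr (p - 1)) < (y - s) * (p * z powr (p - 1))"
          using 1 p by simp
        then show ?thesis using z(3) y sp by (simp add: algebra_simps)
      next
        case 2
        obtain z where z: "y < z" "z < s" "s powr p - y powr p = (s - y) * (p * z powr (p - 1))"
          using MVT2[OF 2, of "\<lambda>x. x powr p" "\<lambda>x. p * x powr (p - 1)"] D y by force
        have "z powr (p - 1) < s powr (p - 1)" using z y p by (intro powr_less_mono2) auto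
        then have "(s - y) * (p * z powr (p - 1)) < (s - y) * (p * s powr (p - 1))"
          using 2 p by simp
        then show ?thesis using z(3) y sp by (simp add: algebra_simps)
      qed
    qed
  qed
  show "p * s powr (p - 1) * y - (p - 1) * s powr p \<le> \<bar>y\<bar> powr p"
  proof (cases "y = s")
    case True
    then show ?thesis using s sp by (simp add: algebra_simps)
  qed (use * in force)
qed

text \<open>Slope and weak second derivative on the left half, with no condition at either end, so
  that the reflected right half is an instance as well.\<close>

definition half_profile :: "real \<Rightarrow> (real \<Rightarrow> real) \<Rightarrow> (real \<Rightarrow> real) \<Rightarrow> bool" where
  "half_profile p u1 g \<longleftrightarrow> g absolutely_integrable_on {0..1/2} \<and>
     (\<forall>x\<in>{0..1/2}. u1 x = u1 0 + integral {0..x} g) \<and>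
     (\<lambda>x. \<bar>elastic_weight p (u1 x) * g x\<bar> powr p) integrable_on {0..1/2}"

definition half_energy :: "real \<Rightarrow> (real \<Rightarrow> real) \<Rightarrow> (real \<Rightarrow> real) \<Rightarrow> real" where
  "half_energy p u1 g = integral {0..1/2} (\<lambda>x. \<bar>elastic_weight p (u1 x) * g x\<bar> powr p)"

lemma half_profileD:
  assumes "half_profile p u1 g"
  shows "g absolutely_integrable_on {0..1/2}" "g integrable_on {0..1/2}"
    "x \<in> {0..1/2} \<Longrightarrow> u1 x = u1 0 + integral {0..x} g"
    "(\<lambda>x. \<bar>elastic_weight p (u1 x) * g x\<bar> powr p) integrable_on {0..1/2}"
    "continuous_on {0..1/2} u1"
proof -
  show g: "g absolutely_integrable_on {0..1/2}"
    using assms unfolding half_profile_def by (rule conjunct1)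
  show gi: "g integrable_on {0..1/2}" using g by (rule set_lebesgue_integral_eq_integral)
  have u: "u1 x = u1 0 + integral {0..x} g" if "x \<in> {0..1/2}" for x
    using assms that unfolding half_profile_def by blast
  then show "x \<in> {0..1/2} \<Longrightarrow> u1 x = u1 0 + integral {0..x} g" .
  show "(\<lambda>x. \<bar>elastic_weight p (u1 x) * g x\<bar> powr p) integrable_on {0..1/2}"
    using assms unfolding half_profile_def by (elim conjE)
  show "continuous_on {0..1/2} u1"
    by (rule continuous_on_indefinite_integral[OF gi u])
qed

context elastic_exponent
begin

text \<open>Translates from angles to slopes via sin (\<alpha> - arctan z) = (sin \<alpha> - z cos
  \<alpha>) / sqrt (1 + z^2). The left side is, up to sign, the z-derivative of
  \<open>sin_int p (\<alpha> - arctan z)\<close>; the right side is the weight times the factor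
  appearing in Young's inequality.\<close>

lemma sin_pow_diff_arctan:
  assumes f: "sin \<alpha> - cos \<alpha> * z \<ge> 0"
  shows "sin_pow p (\<alpha> - arctan z) / (1 + z\<^sup>2) = elastic_weight p z * (sin \<alpha> - cos \<alpha> * z) powr (1 - 1 / p)"
proof -
  have w: "1 + z\<^sup>2 > 0" by (simp add: add_pos_nonneg)
  have "sin (\<alpha> - arctan z) = (sin \<alpha> - cos \<alpha> * z) / sqrt (1 + z\<^sup>2)"
    by (simp add: sin_diff sin_arctan cos_arctan diff_divide_distrib)
  also have "\<dots> = (sin \<alpha> - cos \<alpha> * z) * (1 + z\<^sup>2) powr (- (1 / 2))"
  proof -
    have "(1 + z\<^sup>2) powr (- (1 / 2)) = inverse (sqrt (1 + z\<^sup>2))"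
      by (simp only: powr_minus powr_half_sqrt[OF less_imp_le[OF w]])
    then show ?thesis by (simp only: divide_inverse[of _ "sqrt _"])
  qed
  finally have S: "sin_pow p (\<alpha> - arctan z) = (sin \<alpha> - cos \<alpha> * z) powr (1 - 1 / p) * (1 + z\<^sup>2) powr (- (1 / 2) * (1 - 1 / p))"
    using f by (simp add: sin_pow_def abs_mult powr_mult powr_powr)
  have W: "(1 + z\<^sup>2) powr (- (1 / 2) * (1 - 1 / p)) / (1 + z\<^sup>2) = elastic_weight p z"
  proof -
    have "(1 + z\<^sup>2) powr (- (1 / 2) * (1 - 1 / p)) / (1 + z\<^sup>2) = (1 + z\<^sup>2) powr (- (1 / 2) * (1 - 1 / p)) * (1 + z\<^sup>2) powr (- 1)"
      by (simp only: powr_neg_one[OF w] times_divide_eq_right mult_1_right)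
    also have "\<dots> = (1 + z\<^sup>2) powr (- (1 / 2) * (1 - 1 / p) + - 1)" by (rule powr_add[symmetric])
    also have "- (1 / 2) * (1 - 1 / p) + - 1 = 1 / (2 * p) - 3 / 2" using p_gt_1 by (simp add: field_simps)
    finally show ?thesis by (simp add: elastic_weight_def)
  qed
  show "sin_pow p (\<alpha> - arctan z) / (1 + z\<^sup>2) = elastic_weight p z * (sin \<alpha> - cos \<alpha> * z) powr (1 - 1 / p)"
    unfolding S times_divide_eq_right[symmetric] W by (rule mult.commute)
qed

lemma slope_gap_nonneg:
  assumes "z \<le> tan \<alpha>" "0 < \<alpha>" "\<alpha> < pi / 2"
  shows "sin \<alpha> - cos \<alpha> * z \<ge> 0"
proof -
  have c: "cos \<alpha> > 0" using assms by (intro cos_gt_zero) auto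
  then have "cos \<alpha> * z \<le> cos \<alpha> * tan \<alpha>" using assms by (intro mult_left_mono) auto
  then show ?thesis using c by (simp add: tan_def)
qed

text \<open>\<open>D\<close> is the deficit in Young's inequality with \<open>f = sin \<alpha> - cos \<alpha> * u1\<close>, where the term linear in \<open>g\<close> is
  kept only to the right of the point \<open>x0\<close> of maximal slope.\<close>

lemma half_energy_deficit:
  fixes g u1 :: "real \<Rightarrow> real"
  assumes hp: "half_profile p u1 g"
    and h: "h \<le> integral {0..1/2} u1"
    and \<alpha>: "0 < \<alpha>" "\<alpha> < pi / 2" and le: "\<forall>x\<in>{0..1/2}. u1 x \<le> tan \<alpha>"
    and x0: "x0 \<in> {0..1/2}" "u1 x0 = tan \<alpha>" and t: "t > 0"
  obtains D where "D integrable_on {0..1/2}" "\<And>x. x \<in> {0..1/2} \<Longrightarrow> 0 \<le> D x"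
    "\<And>x. x \<in> {0..1/2} \<Longrightarrow> D x = 0 \<Longrightarrow> - (elastic_weight p (u1 x) * g x) = t * (sin \<alpha> - cos \<alpha> * u1 x) powr (1 / p)"
    "integral {0..1/2} D \<le> half_energy p u1 g -
       (p * t powr (p - 1) * sin_int p (\<alpha> - arctan (u1 (1/2))) - (p - 1) * t powr p * tilt h \<alpha>)"
    "tilt h \<alpha> \<ge> 0"
proof -
  note g = half_profileD(1)[OF hp] and gi = half_profileD(2)[OF hp] and u1 = half_profileD(3)[OF hp]
    and e = half_profileD(4)[OF hp] and cu = half_profileD(5)[OF hp]
  let ?e = "\<lambda>x. \<bar>elastic_weight p (u1 x) * g x\<bar> powr p"
  let ?f = "\<lambda>x. sin \<alpha> - cos \<alpha> * u1 x"
  let ?\<phi> = "\<lambda>z. - (sin_pow p (\<alpha> - arctan z) / (1 + z\<^sup>2))"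
  \<comment> \<open>Left of \<open>x0\<close> the linear term would integrate to a nonpositive
    multiple of \<open>sin_int p (\<alpha> - arctan (u1 0))\<close>, a loss. Without it the two
    other terms of the deficit are nonnegative there.\<close>
  define k where "k x = (if x \<in> {x0..1/2} then p * t powr (p - 1) * (?\<phi> (u1 x) * g x) else 0)" for x
  define D where "D x = ?e x - k x + (p - 1) * t powr p * ?f x" for x
  have c: "cos \<alpha> > 0" using \<alpha> by (intro cos_gt_zero) auto
  have f0: "?f x \<ge> 0" if "x \<in> {0..1/2}" for x using slope_gap_nonneg[OF bspec[OF le that] \<alpha>] .
  have w: "1 + z\<^sup>2 > 0" for z :: real by (simp add: add_pos_nonneg)
  have c\<phi>: "continuous_on UNIV ?\<phi>"
    using w by (intro continuous_intros continuous_on_compose2[OF continuous_sin_pow[of UNIV]]) (auto simp: less_imp_neq[symmetric])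
  have d\<phi>: "((\<lambda>z. sin_int p (\<alpha> - arctan z)) has_real_derivative ?\<phi> z) (at z)" for z
  proof -
    have "- pi < \<alpha> - arctan z" using \<alpha> arctan_ubound[of z] pi_gt_zero by linarith
    then have "((\<lambda>z. sin_int p (\<alpha> - arctan z)) has_real_derivative sin_pow p (\<alpha> - arctan z) * (0 - inverse (1 + z\<^sup>2))) (at z)"
      by (intro DERIV_chain2[OF sin_int_deriv] DERIV_diff DERIV_const DERIV_arctan)
    then show ?thesis by (simp add: divide_inverse)
  qed
  have sub: "{x0..1/2} \<subseteq> {0..1/2}" using x0 by auto
  have g0: "g absolutely_integrable_on {x0..1/2}" by (rule absolutely_integrable_on_subinterval[OF g sub])
  have chain: "integral {x0..1/2} (\<lambda>x. ?\<phi> (u1 x) * g x) = sin_int p (\<alpha> - arctan (u1 (1/2))) - sin_int p (\<alpha> - arctan (u1 x0))"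
    using integral_chain_rule_sub[OF g u1 d\<phi> c\<phi>, of x0 "1/2"] x0 by simp
  have at: "arctan (u1 x0) = \<alpha>" unfolding x0(2) using \<alpha> by (intro arctan_tan) auto
  have "(\<lambda>x. ?\<phi> (u1 x) * g x) absolutely_integrable_on {x0..1/2}"
    by (rule absolutely_integrable_continuous_mult[OF _ g0])
       (rule continuous_on_compose2[OF c\<phi> continuous_on_subset[OF cu sub]], simp)
  then have "(\<lambda>x. ?\<phi> (u1 x) * g x) integrable_on {x0..1/2}" by (rule set_lebesgue_integral_eq_integral)
  then have "((\<lambda>x. p * t powr (p - 1) * (?\<phi> (u1 x) * g x)) has_integral p * t powr (p - 1) * sin_int p (\<alpha> - arctan (u1 (1/2)))) {x0..1/2}"
    using chain at by (intro has_integral_mult_right) (simp add: has_integral_integrable_integral)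
  then have k: "(k has_integral p * t powr (p - 1) * sin_int p (\<alpha> - arctan (u1 (1/2)))) {0..1/2}"
    unfolding k_def by (rule iffD2[OF has_integral_restrict[OF sub]])
  have ui: "u1 integrable_on {0..1/2}" using cu by (rule integrable_continuous_interval)
  have "((\<lambda>x. sin \<alpha>) has_integral sin \<alpha> / 2) {0..1/2::real}"
    using has_integral_const_real[of "sin \<alpha>" 0 "1/2"] by simp
  then have f: "(?f has_integral sin \<alpha> / 2 - cos \<alpha> * integral {0..1/2} u1) {0..1/2}"
    by (intro has_integral_diff has_integral_mult_right integrable_integral ui)
  have "((\<lambda>x. ?e x - k x + (p - 1) * t powr p * ?f x) has_integral
     integral {0..1/2} ?e - p * t powr (p - 1) * sin_int p (\<alpha> - arctan (u1 (1/2))) +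
       (p - 1) * t powr p * (sin \<alpha> / 2 - cos \<alpha> * integral {0..1/2} u1)) {0..1/2}"
    by (rule has_integral_add[OF has_integral_diff[OF integrable_integral[OF e] k] has_integral_mult_right[OF f]])
  then have Di: "(D has_integral integral {0..1/2} ?e - p * t powr (p - 1) * sin_int p (\<alpha> - arctan (u1 (1/2))) +
       (p - 1) * t powr p * (sin \<alpha> / 2 - cos \<alpha> * integral {0..1/2} u1)) {0..1/2}"
    by (simp add: D_def[abs_def])
  have til: "sin \<alpha> / 2 - cos \<alpha> * integral {0..1/2} u1 \<le> tilt h \<alpha>"
    using h c by (simp add: tilt_def mult.commute)
  show ?thesis
  proof (rule that)
    show "D integrable_on {0..1/2}" using Di by blast
    show "tilt h \<alpha> \<ge> 0"
      using has_integral_nonneg[OF f f0] til by linarith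
    have "integral {0..1/2} D = integral {0..1/2} ?e - p * t powr (p - 1) * sin_int p (\<alpha> - arctan (u1 (1/2))) +
       (p - 1) * t powr p * (sin \<alpha> / 2 - cos \<alpha> * integral {0..1/2} u1)" using Di by blast
    moreover have "(p - 1) * t powr p * (sin \<alpha> / 2 - cos \<alpha> * integral {0..1/2} u1) \<le> (p - 1) * t powr p * tilt h \<alpha>"
      using p_gt_1 til by (intro mult_left_mono) auto
    ultimately show "integral {0..1/2} D \<le> half_energy p u1 g -
       (p * t powr (p - 1) * sin_int p (\<alpha> - arctan (u1 (1/2))) - (p - 1) * t powr p * tilt h \<alpha>)"
      unfolding half_energy_def by linarith
    have main: "0 \<le> D x \<and> (D x = 0 \<longrightarrow> - (elastic_weight p (u1 x) * g x) = t * ?f x powr (1 / p))"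
      if x: "x \<in> {0..1/2}" for x
    proof -
      define a where "a = elastic_weight p (u1 x) * g x"
      define s where "s = t * ?f x powr (1 / p)"
      have s: "s \<ge> 0" using t by (simp add: s_def)
      have sp: "s powr p = t powr p * ?f x"
        using t f0[OF x] p_gt_1 by (simp add: s_def powr_mult powr_powr)
      have e0: "?e x \<ge> 0" by simp
      show ?thesis
      proof (cases "x \<in> {x0..1/2}")
        case True
        \<comment> \<open>The contact point s = t f^(1/p) is chosen so that both terms of the
          tangent inequality become integrable in closed form: s^p is linear in the slope, and s^(p
          - 1) carries the conjugate power of f.\<close>
        have "s powr (p - 1) = t powr (p - 1) * ?f x powr (1 - 1 / p)"
        proof -
          have "1 / p * (p - 1) = 1 - 1 / p" using p_gt_1 by (simp add: field_simps)
          then show ?thesis using t by (simp only: s_def powr_mult powr_powr)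
        qed
        moreover have "?\<phi> (u1 x) * g x = ?f x powr (1 - 1 / p) * (- a)"
          unfolding sin_pow_diff_arctan[OF f0[OF x]] a_def by simp
        ultimately have "k x = p * s powr (p - 1) * (- a)" using True by (simp add: k_def)
        then have "D x = \<bar>- a\<bar> powr p - (p * s powr (p - 1) * (- a) - (p - 1) * s powr p)"
          unfolding D_def sp by (simp add: a_def)
        then have "0 \<le> D x" "- a \<noteq> s \<Longrightarrow> D x \<noteq> 0"
          using powr_tangent[OF p_gt_1 s, of "- a"] by simp_all
        then show ?thesis unfolding a_def[symmetric] s_def[symmetric] by blast
      next
        case False
        then have "k x = 0" unfolding k_def by (rule if_not_P)
        then have D: "D x = ?e x + (p - 1) * t powr p * ?f x" unfolding D_def by simp
        have pt: "(p - 1) * t powr p > 0" using p_gt_1 t by simp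
        then have nn: "(p - 1) * t powr p * ?f x \<ge> 0" using f0[OF x] by simp
        \<comment> \<open>Even where the linear term was dropped, a vanishing deficit gives the
          elastica equation: both remaining summands are zero, and the equation reads 0 = 0.\<close>
        have "- a = s" if "D x = 0"
        proof -
          have "?e x = 0" "(p - 1) * t powr p * ?f x = 0" using that D e0 nn by linarith+
          then have "a = 0" "?f x = 0" using pt by (auto simp: a_def)
          then show ?thesis by (simp add: s_def)
        qed
        moreover have "0 \<le> D x" using D e0 nn by linarith
        ultimately show ?thesis unfolding a_def s_def by blast
      qed
    qed
    show "0 \<le> D x" if "x \<in> {0..1/2}" for x using main[OF that] by blast
    show "- (elastic_weight p (u1 x) * g x) = t * ?f x powr (1 / p)" if "x \<in> {0..1/2}" "D x = 0" for x
      using main[OF that(1)] that(2) by blast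
  qed
qed

end

section \<open>From one half to the whole interval: splitting, reflection and the lower
  bound\<close>

lemma nonneg_integral_0_negligible:
  fixes D :: "real \<Rightarrow> real"
  assumes D: "D integrable_on S" "\<And>x. x \<in> S \<Longrightarrow> 0 \<le> D x" and le: "integral S D \<le> 0"
  shows "negligible {x \<in> S. D x \<noteq> 0}"
proof -
  have abs: "D absolutely_integrable_on S"
    using D by (simp add: absolutely_integrable_on_iff_nonneg)
  define F where "F x = indicator S x *\<^sub>R D x" for x
  have F: "integrable lebesgue F" using abs unfolding set_integrable_def F_def .
  have F0: "F x \<ge> 0" for x using D(2) by (simp add: F_def indicator_def)
  have "integral\<^sup>L lebesgue F = integral S D"
    using set_lebesgue_integral_eq_integral(2)[OF abs] by (simp add: set_lebesgue_integral_def F_def[abs_def])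
  moreover have "integral\<^sup>L lebesgue F \<ge> 0" using F0 by (intro Bochner_Integration.integral_nonneg)
  ultimately have "integral\<^sup>L lebesgue F = 0" using le by linarith
  then have "AE x in lebesgue. F x = 0"
    using integral_nonneg_eq_0_iff_AE[OF F] F0 by simp
  then obtain N where "N \<in> null_sets lebesgue" "\<And>x. x \<notin> N \<Longrightarrow> F x = 0"
    by (rule AE_E3) auto
  moreover from this have "{x \<in> S. D x \<noteq> 0} \<subseteq> N" by (fastforce simp: F_def)
  ultimately show ?thesis using negligible_iff_null_sets negligible_subset by blast
qed

lemma has_integral_reflect_1:
  fixes f :: "real \<Rightarrow> real"
  assumes "(f has_integral I) {a..b}"
  shows "((\<lambda>x. f (1 - x)) has_integral I) {1 - b..1 - a}"
proof -
  have "((\<lambda>x. f (- 1 *\<^sub>R x + 1)) has_integral (1 / \<bar>- 1\<bar> ^ DIM(real)) *\<^sub>R I) ((\<lambda>x. (1 / - 1) *\<^sub>R x + - ((1 / - 1) *\<^sub>R 1)) ` cbox a b)"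
    using assms by (intro has_integral_affinity) auto
  moreover have "(\<lambda>x::real. (1 / - 1) *\<^sub>R x + - ((1 / - 1) *\<^sub>R 1)) ` cbox a b = {1 - b..1 - a}"
    by (force simp: image_iff intro!: bexI[of _ "1 - _"])
  ultimately show ?thesis by (simp add: add.commute)
qed

text \<open>The right half is read from the endpoint 1 inwards: its slope becomes - u1 (1 - x), with
  derivative g (1 - x). The boundary value at 1 makes it climb to the same height, and the weight is
  even in the slope.\<close>

lemma W2p_halvesE:
  assumes v: "W2p p v" and p: "p > 1" and v0: "v 0 = 0" and v1: "v 1 = 0"
  obtains u1 g where
    "half_profile p u1 g" "half_profile p (\<lambda>x. - u1 (1 - x)) (\<lambda>x. g (1 - x))"
    "\<And>x. x \<in> {0..1} \<Longrightarrow> v x = integral {0..x} u1"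
    "integral {0..1/2} (\<lambda>x. - u1 (1 - x)) = v (1/2)"
    "Ep p v = half_energy p u1 g + half_energy p (\<lambda>x. - u1 (1 - x)) (\<lambda>x. g (1 - x))"
    "continuous_on {0..1} u1"
proof -
  obtain u1 g where g: "g absolutely_integrable_on {0..1}"
    and cu: "continuous_on {0..1} u1"
    and u1: "\<And>x. x \<in> {0..1} \<Longrightarrow> u1 x = u1 0 + integral {0..x} g"
    and vx: "\<And>x. x \<in> {0..1} \<Longrightarrow> v x = v 0 + integral {0..x} u1"
    and e: "(\<lambda>x. \<bar>elastic_weight p (u1 x) * g x\<bar> powr p) integrable_on {0..1}"
    and E: "Ep p v = integral {0..1} (\<lambda>x. \<bar>elastic_weight p (u1 x) * g x\<bar> powr p)"
    by (rule W2p_energyE[OF v p], rule that, assumption+)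
  let ?e = "\<lambda>x. \<bar>elastic_weight p (u1 x) * g x\<bar> powr p"
  have gi: "g integrable_on {0..1}" "(\<lambda>x. \<bar>g x\<bar>) integrable_on {0..1}"
    using g by (auto simp: absolutely_integrable_on_def)
  have ui: "u1 integrable_on {0..1}" using cu by (rule integrable_continuous_interval)
  have refl: "((\<lambda>x. f (1 - x)) has_integral integral {1 - d..1 - c} f) {c..d}"
    if "f integrable_on {0..1}" "0 \<le> c" "d \<le> 1" for f :: "real \<Rightarrow> real" and c d
  proof -
    have "f integrable_on {1 - d..1 - c}" using that(2,3) by (intro integrable_subinterval_real[OF that(1)]) auto
    then show ?thesis using has_integral_reflect_1[OF integrable_integral, of f "1 - d" "1 - c"] by simp
  qed
  have ew: "elastic_weight p (- z) = elastic_weight p z" for z by (simp add: elastic_weight_def)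
  show ?thesis
  proof (rule that)
    show "half_profile p u1 g"
      unfolding half_profile_def
      using absolutely_integrable_on_subinterval[OF g, of 0 "1/2"] integrable_subinterval_real[OF e, of 0 "1/2"]
      by (auto intro!: u1)
    show "half_profile p (\<lambda>x. - u1 (1 - x)) (\<lambda>x. g (1 - x))"
      unfolding half_profile_def ew
    proof (intro conjI ballI)
      show "(\<lambda>x. g (1 - x)) absolutely_integrable_on {0..1/2}"
        using refl[OF gi(1), of 0 "1/2"] refl[OF gi(2), of 0 "1/2"]
        by (auto simp: absolutely_integrable_on_def)
      show "(\<lambda>x. \<bar>elastic_weight p (u1 (1 - x)) * g (1 - x)\<bar> powr p) integrable_on {0..1/2}"
        using refl[OF e, of 0 "1/2"] by auto
      fix x :: real assume x: "x \<in> {0..1/2}"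
      have "u1 1 = u1 (1 - x) + integral {1 - x..1} g"
        using x by (intro indefinite_integral_rebase[OF gi(1) u1]) auto
      moreover have "integral {0..x} (\<lambda>x. g (1 - x)) = integral {1 - x..1} g"
        using refl[OF gi(1), of 0 x] x by (simp add: integral_unique)
      ultimately show "- u1 (1 - x) = - u1 (1 - 0) + integral {0..x} (\<lambda>x. g (1 - x))" by simp
    qed
    show "v x = integral {0..x} u1" if "x \<in> {0..1}" for x using vx[OF that] v0 by simp
    have comb: "integral {0..1/2} f + integral {1/2..1} f = integral {0..1} f" if "f integrable_on {0..1}" for f :: "real \<Rightarrow> real"
      using that by (intro Henstock_Kurzweil_Integration.integral_combine) auto
    have "integral {0..1/2} (\<lambda>x. u1 (1 - x)) = integral {1/2..1} u1"
      using refl[OF ui, of 0 "1/2"] by (simp add: integral_unique)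
    then show "integral {0..1/2} (\<lambda>x. - u1 (1 - x)) = v (1/2)"
      using comb[OF ui] vx[of "1/2"] vx[of 1] v0 v1 by simp
    have "integral {0..1/2} (\<lambda>x. ?e (1 - x)) = integral {1/2..1} ?e"
      using refl[OF e, of 0 "1/2"] by (simp add: integral_unique)
    then show "Ep p v = half_energy p u1 g + half_energy p (\<lambda>x. - u1 (1 - x)) (\<lambda>x. g (1 - x))"
      unfolding half_energy_def ew E using comb[OF e] by simp
  qed (rule cu)
qed

context elastic_exponent
begin

lemma half_profile_max_angle:
  assumes hp: "half_profile p u1 g" and h: "h > 0" "h \<le> integral {0..1/2} u1"
  obtains \<alpha> x0 where "0 < \<alpha>" "\<alpha> < pi / 2" "\<forall>x\<in>{0..1/2}. u1 x \<le> tan \<alpha>"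
    "x0 \<in> {0..1/2}" "u1 x0 = tan \<alpha>"
proof -
  have cu: "continuous_on {0..1/2} u1" using hp by (rule half_profileD)
  obtain x0 where x0: "x0 \<in> {0..1/2}" "\<And>x. x \<in> {0..1/2} \<Longrightarrow> u1 x \<le> u1 x0"
    using continuous_attains_sup[OF _ _ cu] by auto
  have "integral {0..1/2} u1 \<le> integral {0..1/2::real} (\<lambda>_. u1 x0)"
    using cu x0 by (intro integral_le integrable_continuous_interval) auto
  then have "u1 x0 > 0" using h by simp
  then show ?thesis
    using that[of "arctan (u1 x0)" x0] x0 arctan_ubound by (auto simp: zero_less_arctan_iff tan_arctan)
qed

lemma half_energy_bound:
  assumes hp: "half_profile p u1 g" and h: "h \<le> integral {0..1/2} u1"
    and \<alpha>: "0 < \<alpha>" "\<alpha> < pi / 2" "\<forall>x\<in>{0..1/2}. u1 x \<le> tan \<alpha>"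
      "x0 \<in> {0..1/2}" "u1 x0 = tan \<alpha>"
  shows "t > 0 \<Longrightarrow> p * t powr (p - 1) * sin_int p (\<alpha> - arctan (u1 (1/2))) - (p - 1) * t powr p * tilt h \<alpha> \<le> half_energy p u1 g"
    and "tilt h \<alpha> \<ge> 0" and "arctan (u1 (1/2)) \<le> \<alpha>"
proof -
  show *: "p * t powr (p - 1) * sin_int p (\<alpha> - arctan (u1 (1/2))) - (p - 1) * t powr p * tilt h \<alpha> \<le> half_energy p u1 g"
    if t: "t > 0" for t
  proof (rule half_energy_deficit[OF hp h \<alpha> t])
    fix D assume D: "D integrable_on {0..1/2}" "\<And>x. x \<in> {0..1/2} \<Longrightarrow> 0 \<le> D x"
      "integral {0..1/2} D \<le> half_energy p u1 g -
       (p * t powr (p - 1) * sin_int p (\<alpha> - arctan (u1 (1/2))) - (p - 1) * t powr p * tilt h \<alpha>)"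
    have "integral {0..1/2} D \<ge> 0" by (rule integral_nonneg[OF D(1,2)])
    then show ?thesis using D(3) by linarith
  qed
  show "tilt h \<alpha> \<ge> 0"
    by (rule half_energy_deficit[OF hp h \<alpha> zero_less_one])
  have "arctan (u1 (1/2)) \<le> arctan (tan \<alpha>)" using \<alpha>(3) by (simp add: arctan_le_iff)
  also have "\<dots> = \<alpha>" using \<alpha> by (intro arctan_tan) auto
  finally show "arctan (u1 (1/2)) \<le> \<alpha>" .
qed

text \<open>The angle \<beta> at 1/2 need not vanish. After reflection it enters the halves with
  opposite signs, so the net turning angles a - \<beta> and b + \<beta> always add up to a + b;
  midpoint convexity of \<open>sin_int\<close> then eliminates \<beta>, and \<open>tilt_add\<close>
  merges the tilts. Both halves must use the same scale t for this.\<close>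

theorem energy_lower_bound:
  assumes v: "W2p p v" "v 0 = 0" "v 1 = 0" and h: "h > 0" "h \<le> v (1/2)"
  obtains a where "0 < a" "a < pi / 2" "tilt h a > 0" "2 * arc_energy p h a \<le> Ep p v"
proof -
  obtain u1 g where hp: "half_profile p u1 g" "half_profile p (\<lambda>x. - u1 (1 - x)) (\<lambda>x. g (1 - x))"
    and vx: "\<And>x. x \<in> {0..1} \<Longrightarrow> v x = integral {0..x} u1"
    and v2: "integral {0..1/2} (\<lambda>x. - u1 (1 - x)) = v (1/2)"
    and E: "Ep p v = half_energy p u1 g + half_energy p (\<lambda>x. - u1 (1 - x)) (\<lambda>x. g (1 - x))"
    using W2p_halvesE[OF v(1) p_gt_1 v(2,3)] by metis
  have h1: "h \<le> integral {0..1/2} u1" and h2: "h \<le> integral {0..1/2} (\<lambda>x. - u1 (1 - x))"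
    using h vx[of "1/2"] v2 by auto
  obtain a x1 where a: "0 < a" "a < pi / 2" "\<forall>x\<in>{0..1/2}. u1 x \<le> tan a" "x1 \<in> {0..1/2}" "u1 x1 = tan a"
    using half_profile_max_angle[OF hp(1) h(1) h1] by metis
  obtain b y where b: "0 < b" "b < pi / 2" "\<forall>x\<in>{0..1/2}. - u1 (1 - x) \<le> tan b" "y \<in> {0..1/2}" "- u1 (1 - y) = tan b"
    using half_profile_max_angle[OF hp(2) h(1) h2] by metis
  note A = half_energy_bound[OF hp(1) h1 a] and B = half_energy_bound[OF hp(2) h2 b]
  define \<beta> where "\<beta> = arctan (u1 (1/2))"
  have \<beta>: "\<beta> \<le> a" "- \<beta> \<le> b" using A(3) B(3) by (auto simp: \<beta>_def arctan_minus)
  define m where "m = (a + b) / 2"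
  have m: "0 < m" "m < pi / 2" using a b by (auto simp: m_def)
  have conv: "2 * sin_int p m \<le> sin_int p (a - \<beta>) + sin_int p (b + \<beta>)"
    using sin_int_midpoint_convex[of "a - \<beta>" "b + \<beta>"] \<beta> a b by (simp add: m_def)
  have c: "0 < cos ((a - b) / 2)" using a b by (intro cos_gt_zero_pi) auto
  have tm: "tilt h a + tilt h b = 2 * cos ((a - b) / 2) * tilt h m" by (simp add: tilt_add m_def)
  have t0: "tilt h m \<ge> 0"
    using A(2) B(2) tm c by (metis add_nonneg_nonneg mult_pos_pos zero_le_mult_iff not_le zero_less_numeral less_imp_le)
  have tle: "tilt h a + tilt h b \<le> 2 * tilt h m"
    unfolding tm using t0 c by (simp add: mult_left_le_one_le)
  have bound: "p * t powr (p - 1) * sin_int p m - (p - 1) * t powr p * tilt h m \<le> Ep p v / 2" if t: "t > 0" for t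
  proof -
    have "p * t powr (p - 1) * (2 * sin_int p m) - (p - 1) * t powr p * (2 * tilt h m) \<le>
      p * t powr (p - 1) * (sin_int p (a - \<beta>) + sin_int p (b + \<beta>)) - (p - 1) * t powr p * (tilt h a + tilt h b)"
      using conv tle p_gt_1 by (intro diff_mono mult_left_mono) auto
    also have "\<dots> \<le> Ep p v"
      using A(1)[OF t] B(1)[OF t] unfolding E by (simp add: \<beta>_def arctan_minus algebra_simps)
    finally show ?thesis by (simp add: algebra_simps)
  qed
  have "sin_int p m > 0" using m by (intro sin_int_pos) auto
  from optimal_scale[OF bound this t0] have "tilt h m > 0" "arc_energy p h m \<le> Ep p v / 2"
    by (simp_all only: arc_energy_def)
  then show ?thesis by (intro that[OF m]) auto
qed

end

section \<open>The equality case and uniqueness of symmetric minimizers\<close>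

context elastic_exponent
begin

text \<open>At the optimal scale the lower bound equals \<open>arc_energy p h \<alpha>\<close>, so
  the nonnegative deficit has integral at most 0 and vanishes almost everywhere.\<close>

lemma half_energy_rigid:
  assumes hp: "half_profile p u1 g" and h: "h \<le> integral {0..1/2} u1"
    and \<alpha>: "0 < \<alpha>" "\<alpha> < pi / 2" "\<forall>x\<in>{0..1/2}. u1 x \<le> tan \<alpha>" "x0 \<in> {0..1/2}" "u1 x0 = tan \<alpha>"
    and mid: "u1 (1/2) = 0" and tilt: "tilt h \<alpha> > 0" and E: "half_energy p u1 g \<le> arc_energy p h \<alpha>"
  obtains N where "negligible N"
    "\<And>x. x \<in> {0..1/2} - N \<Longrightarrow>
       - (elastic_weight p (u1 x) * g x) = sin_int p \<alpha> / tilt h \<alpha> * (sin \<alpha> - cos \<alpha> * u1 x) powr (1 / p)"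
proof -
  let ?t = "sin_int p \<alpha> / tilt h \<alpha>"
  have b: "sin_int p \<alpha> > 0" using \<alpha> by (intro sin_int_pos) auto
  then have t: "?t > 0" using tilt by simp
  show ?thesis
  proof (rule half_energy_deficit[OF hp h \<alpha> t])
    fix D assume D: "D integrable_on {0..1/2}" "\<And>x. x \<in> {0..1/2} \<Longrightarrow> 0 \<le> D x"
      "\<And>x. x \<in> {0..1/2} \<Longrightarrow> D x = 0 \<Longrightarrow> - (elastic_weight p (u1 x) * g x) = ?t * (sin \<alpha> - cos \<alpha> * u1 x) powr (1 / p)"
      "integral {0..1/2} D \<le> half_energy p u1 g -
       (p * ?t powr (p - 1) * sin_int p (\<alpha> - arctan (u1 (1/2))) - (p - 1) * ?t powr p * tilt h \<alpha>)"
    have "integral {0..1/2} D \<le> half_energy p u1 g - arc_energy p h \<alpha>"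
      using D(4) unfolding mid arctan_zero_zero diff_zero scale_value[OF b tilt] arc_energy_def .
    then have "negligible {x \<in> {0..1/2}. D x \<noteq> 0}"
      using E by (intro nonneg_integral_0_negligible[OF D(1,2)]) auto
    then show ?thesis by (rule that) (rule D(3), auto)
  qed
qed

text \<open>The case \<alpha> = pi/2 of the identity between angles and slopes; the function is EU_p
  up to an additive constant.\<close>

lemma slope_angle_primitive:
  "((\<lambda>z. - sin_int p (pi / 2 - arctan z)) has_real_derivative elastic_weight p z) (at z)"
proof -
  have "- pi < pi / 2 - arctan z" using arctan_ubound[of z] pi_gt_zero by linarith
  then have "((\<lambda>z. sin_int p (pi / 2 - arctan z)) has_real_derivative sin_pow p (pi / 2 - arctan z) * (0 - inverse (1 + z\<^sup>2))) (at z)"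
    by (intro DERIV_chain2[OF sin_int_deriv] DERIV_diff DERIV_const DERIV_arctan)
  moreover have "- (S * (0 - inverse k)) = S / k" for S k :: real
    by (simp add: divide_inverse)
  ultimately have "((\<lambda>z. - sin_int p (pi / 2 - arctan z)) has_real_derivative sin_pow p (pi / 2 - arctan z) / (1 + z\<^sup>2)) (at z)"
    using DERIV_minus by metis
  moreover have "sin_pow p (pi / 2 - arctan z) / (1 + z\<^sup>2) = elastic_weight p z"
    using sin_pow_diff_arctan[of "pi / 2" z] by simp
  ultimately show ?thesis by simp
qed

text \<open>In the variable \<open>G (u')\<close>, with \<open>G\<close> the primitive of the weight, the extremal equation reads
  \<open>w' = - \<rho> w\<close> with \<open>\<rho>\<close> nonincreasing. Hence the squared distance of two solutions is nondecreasing,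
  and solutions that agree at the right end agree; no Lipschitz condition is needed.\<close>

lemma extremal_profile_unique:
  assumes u: "half_profile p u g" and v: "half_profile p v k" and mid: "u (1/2) = v (1/2)"
    and \<alpha>: "0 < \<alpha>" "\<alpha> < pi / 2" and t: "t > 0"
    and le: "\<forall>x\<in>{0..1/2}. u x \<le> tan \<alpha>" "\<forall>x\<in>{0..1/2}. v x \<le> tan \<alpha>"
    and N: "negligible N" "negligible N'"
    and eu: "\<And>x. x \<in> {0..1/2} - N \<Longrightarrow> - (elastic_weight p (u x) * g x) = t * (sin \<alpha> - cos \<alpha> * u x) powr (1 / p)"
    and ev: "\<And>x. x \<in> {0..1/2} - N' \<Longrightarrow> - (elastic_weight p (v x) * k x) = t * (sin \<alpha> - cos \<alpha> * v x) powr (1 / p)"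
    and x: "x \<in> {0..1/2}"
  shows "u x = v x"
proof -
  define G where "G z = - sin_int p (pi / 2 - arctan z)" for z
  have G: "(G has_real_derivative elastic_weight p z) (at z)" for z
    unfolding G_def by (rule slope_angle_primitive)
  have Gmono: "G a < G b" if "a < b" for a b
    using G elastic_weight_pos by (intro DERIV_pos_imp_increasing[OF that]) blast
  define W where "W x = G (u x) - G (v x)" for x
  define m where "m x = elastic_weight p (u x) * g x - elastic_weight p (v x) * k x" for x
  have prod: "(\<lambda>x. elastic_weight p (u x) * g x) absolutely_integrable_on {0..1/2}" if "half_profile p u g" for u g
    using half_profileD(1,5)[OF that]
    by (intro absolutely_integrable_continuous_mult continuous_on_compose2[OF continuous_elastic_weight[of UNIV]]) auto
  have m: "m absolutely_integrable_on {0..1/2}"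
    unfolding m_def[abs_def] by (intro set_integral_diff prod u v)
  have int: "f integrable_on {0..y}" if "f absolutely_integrable_on {0..1/2}" "y \<in> {0..1/2}" for f :: "real \<Rightarrow> real" and y
    using that(2) by (intro integrable_subinterval_real[OF set_lebesgue_integral_eq_integral(1)[OF that(1)]]) auto
  have Gu: "G (u y) = G (u 0) + integral {0..y} (\<lambda>x. elastic_weight p (u x) * g x)"
    if "half_profile p u g" "y \<in> {0..1/2}" for u g y
    using that(2)
    by (intro integral_chain_rule_sub[OF half_profileD(1)[OF that(1)] half_profileD(3)[OF that(1)] G continuous_elastic_weight]) auto
  have Wm: "W y = W 0 + integral {0..y} m" if y: "y \<in> {0..1/2}" for y
  proof -
    have "integral {0..y} m = integral {0..y} (\<lambda>x. elastic_weight p (u x) * g x) - integral {0..y} (\<lambda>x. elastic_weight p (v x) * k x)"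
      unfolding m_def by (intro Henstock_Kurzweil_Integration.integral_diff int prod u v y)
    then show ?thesis unfolding W_def using Gu[OF u y] Gu[OF v y] by linarith
  qed
  have sq: "((\<lambda>z. z\<^sup>2) has_real_derivative 2 * z) (at z)" for z :: real
    using DERIV_power[OF DERIV_ident, of 2 z] by simp
  \<comment> \<open>The square is a smooth function of the absolutely continuous \<open>W\<close>,
    so the integral chain rule applies to it.\<close>
  have "(W (1/2))\<^sup>2 = (W x)\<^sup>2 + integral {x..1/2} (\<lambda>y. 2 * W y * m y)"
    using x by (intro integral_chain_rule_sub[OF m Wm sq]) (auto intro!: continuous_intros)
  moreover have "integral {x..1/2} (\<lambda>y. 2 * W y * m y) \<ge> 0"
  proof -
    have cW: "continuous_on {0..1/2} W"
      by (rule continuous_on_indefinite_integral[OF set_lebesgue_integral_eq_integral(1)[OF m] Wm])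
    have "(\<lambda>y. (2 * W y) * m y) absolutely_integrable_on {0..1/2}"
      by (intro absolutely_integrable_continuous_mult[OF _ m] continuous_intros cW)
    then have i1: "(\<lambda>y. 2 * W y * m y) integrable_on {x..1/2}"
      using x by (intro integrable_subinterval_real[OF set_lebesgue_integral_eq_integral(1)]) auto
    \<comment> \<open>Set to 0 on the null set where an equation may fail, so that nonnegativity
      holds at every point.\<close>
    define q where "q y = (if y \<in> N \<union> N' then 0 else 2 * W y * m y)" for y
    have neg: "negligible (N \<union> N')" using N by simp
    have "q integrable_on {x..1/2}"
      by (rule integrable_spike[OF i1 neg]) (auto simp: q_def)
    then have "integral {x..1/2} q \<ge> 0"
    proof (rule integral_nonneg)
      fix y assume y: "y \<in> {x..1/2}"
      show "0 \<le> q y"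
      proof (cases "y \<in> N \<union> N'")
        case False
        have y': "y \<in> {0..1/2}" using y x by auto
        have c: "cos \<alpha> > 0" using \<alpha> by (intro cos_gt_zero) auto
        have f0: "sin \<alpha> - cos \<alpha> * u y \<ge> 0" "sin \<alpha> - cos \<alpha> * v y \<ge> 0"
          using slope_gap_nonneg[OF _ \<alpha>] le y' by auto
        have my: "m y = t * ((sin \<alpha> - cos \<alpha> * v y) powr (1 / p) - (sin \<alpha> - cos \<alpha> * u y) powr (1 / p))"
          using eu[of y] ev[of y] y' False by (simp add: m_def algebra_simps)
        have mono: "(sin \<alpha> - cos \<alpha> * b) powr (1 / p) \<le> (sin \<alpha> - cos \<alpha> * a) powr (1 / p)"
          if "a \<le> b" "sin \<alpha> - cos \<alpha> * b \<ge> 0" for a b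
          using that c p_gt_1 by (intro powr_mono2) auto
        \<comment> \<open>Both factors have the sign of u y - v y: G increases with the slope, and
          so does the derivative - t f^(1/p), since f decreases with the slope.\<close>
        have "W y * m y \<ge> 0"
        proof (cases "u y \<le> v y")
          case True
          then have "W y \<le> 0" using Gmono[of "u y" "v y"] by (cases "u y = v y") (auto simp: W_def)
          moreover have "m y \<le> 0" unfolding my using mono[OF True f0(2)] t by (simp add: mult_le_0_iff)
          ultimately show ?thesis by (rule mult_nonpos_nonpos)
        next
          case False
          then have "W y \<ge> 0" using Gmono[of "v y" "u y"] by (auto simp: W_def)
          moreover have "m y \<ge> 0" unfolding my using mono[of "v y" "u y"] False f0(1) t by simp
          ultimately show ?thesis by simp
        qed
        then show ?thesis using False by (simp add: q_def mult.assoc)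
      qed (simp add: q_def)
    qed
    also have "integral {x..1/2} q = integral {x..1/2} (\<lambda>y. 2 * W y * m y)"
      by (rule integral_spike[OF neg]) (auto simp: q_def)
    finally show ?thesis .
  qed
  moreover have "(W (1/2))\<^sup>2 = 0" using mid by (simp add: W_def)
  ultimately have "(W x)\<^sup>2 \<le> 0" by linarith
  then have "G (u x) = G (v x)" by (simp add: W_def)
  then show ?thesis using Gmono[of "u x" "v x"] Gmono[of "v x" "u x"] by (metis less_irrefl linorder_neqE_linordered_idom)
qed

lemma symmetric_slope_mid:
  fixes u1 v :: "real \<Rightarrow> real"
  assumes cu: "continuous_on {0..1} u1" and v: "\<And>x. x \<in> {0..1} \<Longrightarrow> v x = integral {0..x} u1"
    and sym: "\<forall>x\<in>{0..1}. v x = v (1 - x)"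
  shows "u1 (1/2) = 0"
proof -
  have "((\<lambda>y. integral {0..y} u1) has_real_derivative u1 (1/2)) (at (1/2) within {0..1})"
    by (intro integral_has_real_derivative[OF cu]) auto
  then have "((\<lambda>y. integral {0..y} u1) has_real_derivative u1 (1/2)) (at (1/2))"
    by (simp add: at_within_Icc_at)
  then have D: "(v has_real_derivative u1 (1/2)) (at (1/2))"
    by (rule has_field_derivative_transform_within_open[where S="{0<..<1}"]) (auto intro!: v[symmetric])
  then have "((\<lambda>x. v (1 - x)) has_real_derivative u1 (1/2) * (0 - 1)) (at (1/2))"
    by (intro DERIV_chain2[where f=v] DERIV_diff DERIV_const DERIV_ident) simp
  then have "(v has_real_derivative u1 (1/2) * (0 - 1)) (at (1/2))"
    by (rule has_field_derivative_transform_within_open[where S="{0<..<1}"]) (auto intro!: bspec[OF sym, symmetric])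
  from DERIV_unique[OF D this] show ?thesis by simp
qed

text \<open>Symmetry makes the midpoint slope 0, so each half obeys the bound by itself with its own
  maximal angle. The right half costs at least \<open>arc_energy p h b\<close>, hence the left half
  at most that; uniqueness of the minimum forces its angle to be b, and rigidity applies.\<close>

lemma symmetric_minimal_rigid:
  assumes v: "W2p p v" "v 0 = 0" "v 1 = 0" "\<forall>x\<in>{0..1}. v x = v (1 - x)" and h: "h > 0" "h \<le> v (1/2)"
    and b: "0 < b" "b < pi / 2" "arc_height p b / arc_width p b = 2 * h"
    and E: "Ep p v \<le> 2 * arc_energy p h b"
  obtains u1 g N where "half_profile p u1 g" "u1 (1/2) = 0" "\<forall>x\<in>{0..1/2}. u1 x \<le> tan b" "tilt h b > 0"
    "\<And>x. x \<in> {0..1/2} \<Longrightarrow> v x = integral {0..x} u1" "negligible N"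
    "\<And>x. x \<in> {0..1/2} - N \<Longrightarrow>
       - (elastic_weight p (u1 x) * g x) = sin_int p b / tilt h b * (sin b - cos b * u1 x) powr (1 / p)"
proof -
  obtain u1 g where hp: "half_profile p u1 g" "half_profile p (\<lambda>x. - u1 (1 - x)) (\<lambda>x. g (1 - x))"
    and vx: "\<And>x. x \<in> {0..1} \<Longrightarrow> v x = integral {0..x} u1"
    and v2: "integral {0..1/2} (\<lambda>x. - u1 (1 - x)) = v (1/2)"
    and Ev: "Ep p v = half_energy p u1 g + half_energy p (\<lambda>x. - u1 (1 - x)) (\<lambda>x. g (1 - x))"
    and cu: "continuous_on {0..1} u1"
    using W2p_halvesE[OF v(1) p_gt_1 v(2,3)] by metis
  have mid: "u1 (1/2) = 0" by (rule symmetric_slope_mid[OF cu vx v(4)])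
  have h1: "h \<le> integral {0..1/2} u1" and h2: "h \<le> integral {0..1/2} (\<lambda>x. - u1 (1 - x))"
    using h vx[of "1/2"] v2 by auto
  have half: "tilt h a > 0 \<and> arc_energy p h a \<le> half_energy p u g"
    if "half_profile p u g" "h \<le> integral {0..1/2} u" "u (1/2) = 0" "0 < a" "a < pi / 2"
      "\<forall>x\<in>{0..1/2}. u x \<le> tan a" "x \<in> {0..1/2}" "u x = tan a" for u g a x
  proof -
    note B = half_energy_bound[OF that(1,2,4-8)]
    have "sin_int p a > 0" using that by (intro sin_int_pos) auto
    moreover have "p * t powr (p - 1) * sin_int p a - (p - 1) * t powr p * tilt h a \<le> half_energy p u g" if "t > 0" for t
      using B(1)[OF that] by (simp add: \<open>u (1/2) = 0\<close>)
    ultimately show ?thesis using optimal_scale[of "sin_int p a" "tilt h a" "half_energy p u g"] B(2)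
      unfolding arc_energy_def by blast
  qed
  have ge: "arc_energy p h b \<le> arc_energy p h a" if "0 < a" "a < pi / 2" "tilt h a > 0" for a
    using arc_energy_unique_min[OF h(1) b that] by (cases "a = b") auto
  obtain a x1 where a: "0 < a" "a < pi / 2" "\<forall>x\<in>{0..1/2}. u1 x \<le> tan a" "x1 \<in> {0..1/2}" "u1 x1 = tan a"
    using half_profile_max_angle[OF hp(1) h(1) h1] by metis
  obtain c y where c: "0 < c" "c < pi / 2" "\<forall>x\<in>{0..1/2}. - u1 (1 - x) \<le> tan c" "y \<in> {0..1/2}" "- u1 (1 - y) = tan c"
    using half_profile_max_angle[OF hp(2) h(1) h2] by metis
  have A: "tilt h a > 0" "arc_energy p h a \<le> half_energy p u1 g"
    using half[OF hp(1) h1 mid a] by auto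
  have C: "tilt h c > 0" "arc_energy p h c \<le> half_energy p (\<lambda>x. - u1 (1 - x)) (\<lambda>x. g (1 - x))"
    using half[OF hp(2) h2 _ c] mid by auto
  have le: "half_energy p u1 g \<le> arc_energy p h b"
    using E Ev C ge[OF c(1,2) C(1)] by linarith
  then have "arc_energy p h a \<le> arc_energy p h b" using A by linarith
  then have ab: "a = b" using arc_energy_unique_min[OF h(1) b a(1,2) A(1)] by fastforce
  show ?thesis
  proof (rule half_energy_rigid[OF hp(1) h1 a mid A(1)])
    show "half_energy p u1 g \<le> arc_energy p h a" using le ab by simp
    fix N assume N: "negligible N" "\<And>x. x \<in> {0..1/2} - N \<Longrightarrow>
       - (elastic_weight p (u1 x) * g x) = sin_int p a / tilt h a * (sin a - cos a * u1 x) powr (1 / p)"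
    show ?thesis
      by (rule that[OF hp(1) mid _ _ _ N(1)]) (use a A vx N(2) ab in auto)
  qed
qed

text \<open>Both slopes solve the same first-order equation, with the same angle b and the same
  scale, and both vanish at 1/2.\<close>

theorem symmetric_minimal_unique:
  assumes b: "0 < b" "b < pi / 2" "arc_height p b / arc_width p b = 2 * h" and h: "h > 0"
    and v: "W2p p v" "v 0 = 0" "v 1 = 0" "\<forall>x\<in>{0..1}. v x = v (1 - x)" "h \<le> v (1/2)" "Ep p v \<le> 2 * arc_energy p h b"
    and w: "W2p p w" "w 0 = 0" "w 1 = 0" "\<forall>x\<in>{0..1}. w x = w (1 - x)" "h \<le> w (1/2)" "Ep p w \<le> 2 * arc_energy p h b"
    and x: "x \<in> {0..1}"
  shows "v x = w x"
proof -
  obtain u g N where u: "half_profile p u g" "u (1/2) = 0" "\<forall>x\<in>{0..1/2}. u x \<le> tan b" "tilt h b > 0"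
    and vu: "\<And>x. x \<in> {0..1/2} \<Longrightarrow> v x = integral {0..x} u" and N: "negligible N"
    and eu: "\<And>x. x \<in> {0..1/2} - N \<Longrightarrow>
       - (elastic_weight p (u x) * g x) = sin_int p b / tilt h b * (sin b - cos b * u x) powr (1 / p)"
    using symmetric_minimal_rigid[OF v(1-4) h v(5) b v(6)] by metis
  obtain u' g' N' where u': "half_profile p u' g'" "u' (1/2) = 0" "\<forall>x\<in>{0..1/2}. u' x \<le> tan b"
    and wu: "\<And>x. x \<in> {0..1/2} \<Longrightarrow> w x = integral {0..x} u'" and N': "negligible N'"
    and eu': "\<And>x. x \<in> {0..1/2} - N' \<Longrightarrow>
       - (elastic_weight p (u' x) * g' x) = sin_int p b / tilt h b * (sin b - cos b * u' x) powr (1 / p)"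
    using symmetric_minimal_rigid[OF w(1-4) h w(5) b w(6)] by metis
  have t: "sin_int p b / tilt h b > 0" using u(4) sin_int_pos[of b] b by simp
  have eq: "u x = u' x" if "x \<in> {0..1/2}" for x
    by (rule extremal_profile_unique[OF u(1) u'(1) _ b(1,2) t u(3) u'(3) N N' eu eu' that]) (use u u' in auto)
  have half: "v x = w x" if "x \<in> {0..1/2}" for x
    unfolding vu[OF that] wu[OF that] using that by (intro integral_cong eq) auto
  show ?thesis
  proof (cases "x \<le> 1/2")
    case True then show ?thesis using half x by auto
  next
    case False
    then have "v (1 - x) = w (1 - x)" using x by (intro half) auto
    moreover have "v x = v (1 - x)" "w x = w (1 - x)" using v(4) w(4) x by blast+
    ultimately show ?thesis by linarith
  qed
qed

end

section \<open>Competitors built from elastica arcs\<close>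

text \<open>One construction for two purposes: \<open>\<epsilon> = 0\<close> gives the minimizer,
  positive \<open>\<epsilon>\<close> the competitors with an initial steep segment. The segment
  itself carries no energy; it only leaves less width for the arc.\<close>

locale arc_graph = elastic_exponent +
  fixes \<alpha> \<epsilon> :: real
  assumes \<alpha>: "0 < \<alpha>" "\<alpha> < pi / 2" and \<epsilon>: "0 \<le> \<epsilon>" "\<epsilon> < 1 / 2"
begin

text \<open>Factor by which the normalized arc is shrunk to fit into [\<epsilon>, 1/2]; it is the
  constant t in |\<kappa>| = t (sin (\<alpha> - \<theta>))^(1/p).\<close>

definition scale :: real where
  "scale = arc_width p \<alpha> / (1 / 2 - \<epsilon>)"

text \<open>\<open>run\<close> and \<open>rise\<close> are the horizontal and vertical coordinates
  of the normalized arc, parametrized by the angle turned since the inflection point. The graph over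
  the x-axis is obtained by inverting \<open>run\<close>.\<close>

definition run :: "real \<Rightarrow> real" where
  "run \<phi> = cos \<alpha> * (p / (p - 1) * sin_pow p \<phi>) + sin \<alpha> * sin_int p \<phi>"

definition rise :: "real \<Rightarrow> real" where
  "rise \<phi> = sin \<alpha> * (p / (p - 1) * sin_pow p \<phi>) - cos \<alpha> * sin_int p \<phi>"

text \<open>Angle by which the tangent has turned at abscissa \<open>x\<close>: the graph starts with a segment of
  slope \<open>tan \<alpha>\<close> over \<open>[0, \<epsilon>]\<close>, followed by the rescaled elastica arc.\<close>

definition turn :: "real \<Rightarrow> real" where
  "turn x = the_inv_into {0..\<alpha>} run (max 0 (scale * (x - \<epsilon>)))"

definition slope :: "real \<Rightarrow> real" where
  "slope x = tan (\<alpha> - turn x)"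

text \<open>Curvature divided by the cube of the cosine of the tangent angle. As
  \<open>0 powr (1 / p) = 0\<close>, the same formula covers the straight segment and is continuous
  where the arc begins.\<close>

definition slope' :: "real \<Rightarrow> real" where
  "slope' x = - (scale * sin (turn x) powr (1 / p) / cos (\<alpha> - turn x) ^ 3)"

lemma scale_pos: "scale > 0"
  using arc_width_pos[of \<alpha>] \<alpha> \<epsilon> by (simp add: scale_def)

lemma sin_pow_0 [simp]: "sin_pow p 0 = 0"
  by (simp add: sin_pow_def)

lemma run_0 [simp]: "run 0 = 0" and rise_0 [simp]: "rise 0 = 0"
  by (simp_all add: run_def rise_def)

lemma run_alpha: "run \<alpha> = arc_width p \<alpha>" and rise_alpha: "rise \<alpha> = arc_height p \<alpha>"
  by (simp_all add: run_def rise_def arc_width_def arc_height_def mult.commute)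

lemma run_rise_deriv:
  assumes "0 < \<phi>" "\<phi> < pi"
  shows "(run has_real_derivative cos (\<alpha> - \<phi>) * sin \<phi> powr (- (1 / p))) (at \<phi>)"
    and "(rise has_real_derivative sin (\<alpha> - \<phi>) * sin \<phi> powr (- (1 / p))) (at \<phi>)"
proof -
  let ?q = "sin \<phi> powr (- (1 / p))"
  have \<phi>: "\<phi> > - pi" using assms pi_gt_zero by linarith
  note S = sin_pow_deriv[OF assms] and B = sin_int_deriv[OF \<phi>]
  have "(run has_real_derivative cos \<alpha> * (cos \<phi> * ?q) + sin \<alpha> * sin_pow p \<phi>) (at \<phi>)"
    unfolding run_def[abs_def] by (intro DERIV_add DERIV_cmult S B)
  then show "(run has_real_derivative cos (\<alpha> - \<phi>) * ?q) (at \<phi>)"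
    by (simp add: sin_pow_eq[OF assms] cos_diff distrib_right mult.assoc)
  have "(rise has_real_derivative sin \<alpha> * (cos \<phi> * ?q) - cos \<alpha> * sin_pow p \<phi>) (at \<phi>)"
    unfolding rise_def[abs_def] by (intro DERIV_diff DERIV_cmult S B)
  then show "(rise has_real_derivative sin (\<alpha> - \<phi>) * ?q) (at \<phi>)"
    by (simp add: sin_pow_eq[OF assms] sin_diff left_diff_distrib mult.assoc)
qed

lemma continuous_run: "continuous_on {0..\<alpha>} run" and continuous_rise: "continuous_on {0..\<alpha>} rise"
proof -
  have sub: "{0..\<alpha>} \<subseteq> {- pi<..}" by (auto intro: less_le_trans[of _ 0])
  show "continuous_on {0..\<alpha>} run" "continuous_on {0..\<alpha>} rise"
    unfolding run_def rise_def
    by (intro continuous_intros continuous_sin_pow continuous_sin_int[OF sub])+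
qed

lemma cos_pos: "\<phi> \<in> {0..\<alpha>} \<Longrightarrow> cos (\<alpha> - \<phi>) > 0"
  using \<alpha> by (intro cos_gt_zero_pi) auto

lemma run_strict_mono:
  assumes "0 \<le> a" "a < b" "b \<le> \<alpha>"
  shows "run a < run b"
proof (rule DERIV_pos_imp_increasing_open[OF assms(2)])
  fix x assume x: "a < x" "x < b"
  then have x0: "0 < x" "x < pi" using assms \<alpha> by auto
  have "cos (\<alpha> - x) * sin x powr (- (1 / p)) > 0"
    using cos_pos[of x] sin_gt_zero[OF x0] x assms by simp
  then show "\<exists>y. (run has_real_derivative y) (at x) \<and> y > 0" using run_rise_deriv(1)[OF x0] by blast
qed (use assms in \<open>auto intro: continuous_on_subset[OF continuous_run]\<close>)

lemma run_inj: "inj_on run {0..\<alpha>}"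
  by (rule linorder_inj_onI) (use run_strict_mono in \<open>force+\<close>)

lemma run_image: "run ` {0..\<alpha>} = {0..arc_width p \<alpha>}"
proof (intro equalityI subsetI)
  fix y assume "y \<in> run ` {0..\<alpha>}"
  then obtain x where x: "0 \<le> x" "x \<le> \<alpha>" "y = run x" by auto
  have "run 0 \<le> run x" using run_strict_mono[of 0 x] x by (cases "x = 0") auto
  moreover have "run x \<le> run \<alpha>" using run_strict_mono[of x \<alpha>] x by (cases "x = \<alpha>") auto
  ultimately show "y \<in> {0..arc_width p \<alpha>}" using x run_alpha by simp
next
  fix y assume "y \<in> {0..arc_width p \<alpha>}"
  then have "\<exists>x\<ge>0. x \<le> \<alpha> \<and> run x = y"
    using \<alpha> run_alpha by (intro IVT' continuous_run) auto
  then show "y \<in> run ` {0..\<alpha>}" by force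
qed

lemma turn_arg: "x \<le> 1 / 2 \<Longrightarrow> max 0 (scale * (x - \<epsilon>)) \<in> {0..arc_width p \<alpha>}"
proof -
  assume x: "x \<le> 1 / 2"
  have "scale * (x - \<epsilon>) \<le> scale * (1 / 2 - \<epsilon>)" using x scale_pos by (intro mult_left_mono) auto
  also have "\<dots> = arc_width p \<alpha>" using \<epsilon> by (simp add: scale_def)
  finally show ?thesis using arc_width_pos[of \<alpha>] \<alpha> by auto
qed

lemma turn_mem: "x \<le> 1 / 2 \<Longrightarrow> turn x \<in> {0..\<alpha>}"
  unfolding turn_def by (rule the_inv_into_into[OF run_inj]) (use turn_arg run_image in auto)

lemma run_turn: "x \<le> 1 / 2 \<Longrightarrow> run (turn x) = max 0 (scale * (x - \<epsilon>))"
  unfolding turn_def by (rule f_the_inv_into_f[OF run_inj]) (use turn_arg run_image in auto)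

lemma turn_unique: "x \<le> 1 / 2 \<Longrightarrow> \<phi> \<in> {0..\<alpha>} \<Longrightarrow> run \<phi> = max 0 (scale * (x - \<epsilon>)) \<Longrightarrow> turn x = \<phi>"
  using run_turn turn_mem run_inj by (metis inj_onD)

lemma turn_left: "x \<le> \<epsilon> \<Longrightarrow> turn x = 0"
  using \<alpha> \<epsilon> scale_pos by (intro turn_unique) (auto simp: max_def mult_le_0_iff zero_le_mult_iff)

lemma turn_half: "turn (1 / 2) = \<alpha>"
proof (rule turn_unique)
  have "scale * (1 / 2 - \<epsilon>) = arc_width p \<alpha>" using \<epsilon> by (simp add: scale_def)
  then show "run \<alpha> = max 0 (scale * (1 / 2 - \<epsilon>))" using run_alpha arc_width_pos[of \<alpha>] \<alpha> by simp
qed (use \<alpha> in auto)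

lemma turn_mono: "x \<le> y \<Longrightarrow> y \<le> 1 / 2 \<Longrightarrow> turn x \<le> turn y"
proof (rule ccontr)
  assume xy: "x \<le> y" "y \<le> 1 / 2" and "\<not> turn x \<le> turn y"
  then have "run (turn y) < run (turn x)" using turn_mem[of x] turn_mem[of y] by (intro run_strict_mono) auto
  moreover have "scale * (x - \<epsilon>) \<le> scale * (y - \<epsilon>)" using xy scale_pos by (intro mult_left_mono) auto
  ultimately show False using run_turn[of x] run_turn[of y] xy by (auto simp: max_def split: if_splits)
qed

lemma continuous_turn: "continuous_on {..1 / 2} turn"
proof -
  have "continuous_on (run ` {0..\<alpha>}) (the_inv_into {0..\<alpha>} run)"
    by (rule continuous_on_inv[OF continuous_run]) (auto simp: the_inv_into_f_f[OF run_inj])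
  then have "continuous_on {0..arc_width p \<alpha>} (the_inv_into {0..\<alpha>} run)" by (simp add: run_image)
  then show ?thesis unfolding turn_def
    by (rule continuous_on_compose2) (use turn_arg in \<open>auto intro!: continuous_intros\<close>)
qed

text \<open>The inverse function rule needs a finite derivative of \<open>run\<close>, which blows
  up at angle 0; so the junction x = \<epsilon> is left out and treated as an exceptional point in
  the later integrations.\<close>

lemma turn_deriv:
  assumes x: "\<epsilon> < x" "x < 1 / 2"
  shows "0 < turn x" "turn x < pi"
    and "(turn has_real_derivative scale * sin (turn x) powr (1 / p) / cos (\<alpha> - turn x)) (at x)"
proof -
  have run: "run (turn y) = scale * (y - \<epsilon>)" if "\<epsilon> < y" "y < 1 / 2" for y
    using run_turn[of y] that scale_pos by simp
  have "turn x \<noteq> 0" using run[OF x] x scale_pos by auto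
  then show 0: "0 < turn x" "turn x < pi" using turn_mem[of x] x \<alpha> by auto
  have s: "sin (turn x) > 0" using 0 by (rule sin_gt_zero)
  have c: "cos (\<alpha> - turn x) > 0" using turn_mem[of x] x by (intro cos_pos) auto
  define D where "D = cos (\<alpha> - turn x) * sin (turn x) powr (- (1 / p))"
  have D: "D > 0" using s c by (simp add: D_def)
  have "((\<lambda>y. run y / scale + \<epsilon>) has_real_derivative D / scale + 0) (at (turn x))"
    unfolding D_def by (intro DERIV_add DERIV_cdivide run_rise_deriv 0 DERIV_const)
  then have 1: "((\<lambda>y. run y / scale + \<epsilon>) has_real_derivative D / scale) (at (turn x))" by simp
  have "continuous_on {..<1 / 2} turn" by (rule continuous_on_subset[OF continuous_turn]) auto
  then have "isCont turn x"
    using continuous_on_eq_continuous_at[of "{..<1 / 2}" turn] x by auto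
  then have "(turn has_real_derivative inverse (D / scale)) (at x)"
    using D scale_pos run x by (intro DERIV_inverse_function[where f="\<lambda>y. run y / scale + \<epsilon>" and g=turn and x=x and a=\<epsilon> and b="1 / 2", OF 1])
      (auto simp: field_simps)
  moreover have "inverse (D / scale) = scale * sin (turn x) powr (1 / p) / cos (\<alpha> - turn x)"
  proof -
    have "sin (turn x) powr (- (1 / p)) = inverse (sin (turn x) powr (1 / p))" by (rule powr_minus)
    then show ?thesis unfolding D_def using scale_pos s c by (simp add: field_simps)
  qed
  ultimately show "(turn has_real_derivative scale * sin (turn x) powr (1 / p) / cos (\<alpha> - turn x)) (at x)" by simp
qed

lemma continuous_slope: "continuous_on {..1 / 2} slope" and continuous_slope': "continuous_on {..1 / 2} slope'"
proof -
  have c: "cos (\<alpha> - turn x) \<noteq> 0" if "x \<le> 1 / 2" for x using cos_pos[OF turn_mem[OF that]] by simp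
  have s: "0 \<le> sin (turn x)" if "x \<le> 1 / 2" for x
    using turn_mem[OF that] \<alpha> by (intro sin_ge_zero) auto
  show "continuous_on {..1 / 2} slope" unfolding slope_def
    by (intro continuous_intros continuous_turn) (use c in auto)
  have q: "continuous_on {..1 / 2} (\<lambda>x. sin (turn x) powr (1 / p))"
    using p_gt_1 s by (intro continuous_on_powr' continuous_intros continuous_turn) auto
  show "continuous_on {..1 / 2} slope'" unfolding slope'_def
    by (intro continuous_on_minus continuous_on_divide continuous_on_mult q continuous_on_const
          continuous_on_power continuous_on_cos continuous_on_diff continuous_turn) (use c in auto)
qed

lemma slope_deriv:
  assumes x: "x < 1 / 2" "x \<noteq> \<epsilon>"
  shows "(slope has_real_derivative slope' x) (at x)"
proof (cases "x < \<epsilon>")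
  case True
  have "((\<lambda>_. tan \<alpha>) has_real_derivative 0) (at x)" by simp
  then have "(slope has_real_derivative 0) (at x)"
    by (rule has_field_derivative_transform_within_open[where S="{..<\<epsilon>}"]) (use True in \<open>auto simp: slope_def turn_left\<close>)
  then show ?thesis using True by (simp add: slope'_def turn_left)
next
  case False
  then have x': "\<epsilon> < x" using x by simp
  let ?c = "cos (\<alpha> - turn x)"
  have c: "?c \<noteq> 0" using cos_pos[OF turn_mem, of x] x by simp
  have "(slope has_real_derivative inverse (?c\<^sup>2) * (0 - scale * sin (turn x) powr (1 / p) / ?c)) (at x)"
    unfolding slope_def[abs_def]
    by (intro DERIV_chain2[where f=tan] DERIV_tan c DERIV_diff DERIV_const turn_deriv x' x)
  moreover have "inverse (?c\<^sup>2) * (0 - scale * sin (turn x) powr (1 / p) / ?c) = slope' x"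
    unfolding slope'_def using c by (simp add: field_simps power2_eq_square power3_eq_cube)
  ultimately show ?thesis by simp
qed

lemma slope_antimono:
  assumes "x \<le> y" "y \<le> 1 / 2"
  shows "slope y \<le> slope x"
  unfolding slope_def using turn_mono[OF assms] turn_mem[of x] turn_mem[of y] assms \<alpha>
  by (intro tan_mono_le) auto

lemma slope_half: "slope (1 / 2) = 0"
  by (simp add: slope_def turn_half)

lemma slope_has_integral: "(slope has_integral \<epsilon> * tan \<alpha> + arc_height p \<alpha> / scale) {0..1 / 2}"
proof -
  \<comment> \<open>An explicit primitive: the height gained on the arc plus that gained on the
    straight segment, where the minimum freezes the latter beyond \<open>\<epsilon>\<close>.\<close>
  define H where "H x = rise (turn x) / scale + tan \<alpha> * min x \<epsilon>" for x
  have "(slope has_integral H (1 / 2) - H 0) {0..1 / 2}"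
  proof (rule fundamental_theorem_of_calculus_interior_strong[where S="{\<epsilon>}"])
    show "continuous_on {0..1 / 2} H"
      unfolding H_def using scale_pos turn_mem
      by (intro continuous_intros continuous_on_compose2[OF continuous_rise]
            continuous_on_subset[OF continuous_turn]) auto
    fix x assume x: "x \<in> {0<..<1 / 2} - {\<epsilon>}"
    show "(H has_vector_derivative slope x) (at x)"
    proof (cases "x < \<epsilon>")
      case True
      have "((\<lambda>x. tan \<alpha> * x) has_real_derivative tan \<alpha> * 1) (at x)" by (intro DERIV_cmult DERIV_ident)
      then have "(H has_real_derivative tan \<alpha> * 1) (at x)"
        by (rule has_field_derivative_transform_within_open[where S="{..<\<epsilon>}"]) (use True in \<open>auto simp: H_def turn_left\<close>)
      then show ?thesis using True
        by (simp add: slope_def turn_left has_real_derivative_iff_has_vector_derivative)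
    next
      case False
      then have x': "\<epsilon> < x" "x < 1 / 2" using x by auto
      note T = turn_deriv[OF x']
      let ?s = "sin (turn x)" and ?c = "cos (\<alpha> - turn x)"
      have s: "?s > 0" using T(1,2) by (rule sin_gt_zero)
      have "((\<lambda>x. rise (turn x) / scale + tan \<alpha> * \<epsilon>) has_real_derivative
         sin (\<alpha> - turn x) * ?s powr (- (1 / p)) * (scale * ?s powr (1 / p) / ?c) / scale + 0) (at x)"
        by (intro DERIV_add DERIV_cdivide DERIV_const DERIV_chain2[where f=rise] run_rise_deriv T)
      moreover have "sin (\<alpha> - turn x) * ?s powr (- (1 / p)) * (scale * ?s powr (1 / p) / ?c) / scale + 0 = slope x"
        using s scale_pos by (simp add: slope_def tan_def powr_minus)
      ultimately have "((\<lambda>x. rise (turn x) / scale + tan \<alpha> * \<epsilon>) has_real_derivative slope x) (at x)" by simp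
      then have "(H has_real_derivative slope x) (at x)"
        by (rule has_field_derivative_transform_within_open[where S="{\<epsilon><..}"]) (use x' in \<open>auto simp: H_def\<close>)
      then show ?thesis by (simp add: has_real_derivative_iff_has_vector_derivative)
    qed
  qed auto
  moreover have "H (1 / 2) - H 0 = \<epsilon> * tan \<alpha> + arc_height p \<alpha> / scale"
    using \<epsilon> by (simp add: H_def turn_half turn_left rise_alpha)
  ultimately show ?thesis by simp
qed

text \<open>Equality in Young's inequality along the constructed graph. The energy density becomes
  affine in the slope, so its integral depends only on the height reached at 1/2.\<close>

lemma slope_energy_density:
  assumes "x \<le> 1 / 2"
  shows "\<bar>elastic_weight p (slope x) * slope' x\<bar> powr p = scale powr p * (sin \<alpha> - cos \<alpha> * slope x)"
proof -
  define c where "c = cos (\<alpha> - turn x)"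
  define s where "s = sin (turn x)"
  have c: "c > 0" unfolding c_def by (rule cos_pos[OF turn_mem[OF assms]])
  have s: "s \<ge> 0" unfolding s_def using turn_mem[OF assms] \<alpha> by (intro sin_ge_zero) auto
  have "1 + (slope x)\<^sup>2 = inverse (c\<^sup>2)"
    using c tan_sec[of "\<alpha> - turn x"] by (simp add: slope_def c_def power_inverse)
  also have "\<dots> = c powr (- 2)" using c by (simp add: powr_minus)
  finally have "elastic_weight p (slope x) = c powr (- 2 * (1 / (2 * p) - 3 / 2))"
    by (simp only: elastic_weight_def powr_powr)
  also have "- 2 * (1 / (2 * p) - 3 / 2) = 3 + - (1 / p)" using p_gt_1 by (simp add: field_simps)
  also have "c powr (3 + - (1 / p)) = c ^ 3 * c powr (- (1 / p))"
    using c by (simp only: powr_add) simp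
  finally have "\<bar>elastic_weight p (slope x) * slope' x\<bar> = scale * s powr (1 / p) * c powr (- (1 / p))"
    using c scale_pos by (simp add: slope'_def c_def[symmetric] s_def[symmetric] abs_mult)
  then have "\<bar>elastic_weight p (slope x) * slope' x\<bar> powr p = scale powr p * ((s powr (1 / p)) powr p * (c powr (- (1 / p))) powr p)"
    using c s scale_pos by (simp add: powr_mult)
  also have "(s powr (1 / p)) powr p = s" using s p_gt_1 by (simp add: powr_powr)
  also have "(c powr (- (1 / p))) powr p = inverse c"
  proof -
    have "- (1 / p) * p = - 1" using p_gt_1 by simp
    then have "(c powr (- (1 / p))) powr p = 1 / c" by (simp only: powr_powr powr_neg_one[OF c])
    then show ?thesis by (simp add: inverse_eq_divide)
  qed
  also have "s * inverse c = sin \<alpha> - cos \<alpha> * slope x"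
  proof -
    have "s = sin (\<alpha> - (\<alpha> - turn x))" by (simp add: s_def)
    also have "\<dots> = sin \<alpha> * c - cos \<alpha> * sin (\<alpha> - turn x)" by (simp only: sin_diff c_def)
    finally show ?thesis using c by (simp add: slope_def tan_def c_def[symmetric] field_simps)
  qed
  finally show ?thesis .
qed

end

section \<open>The symmetric graph over the whole interval and its energy\<close>

context arc_graph
begin

definition full_slope :: "real \<Rightarrow> real" where
  "full_slope x = (if x \<le> 1 / 2 then slope x else - slope (1 - x))"

definition full_slope' :: "real \<Rightarrow> real" where
  "full_slope' x = (if x \<le> 1 / 2 then slope' x else slope' (1 - x))"

definition graph :: "real \<Rightarrow> real" where
  "graph x = integral {0..x} full_slope"

lemma continuous_full_slope: "continuous_on {0..1} full_slope"
  and continuous_full_slope': "continuous_on {0..1} full_slope'"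
proof -
  have 1: "continuous_on {t \<in> {0..1}. t \<le> 1 / 2} f"
    if "continuous_on {..1 / 2} f" for f :: "real \<Rightarrow> real"
    by (rule continuous_on_subset[OF that]) auto
  have 2: "continuous_on {t \<in> {0..1}. 1 / 2 \<le> t} (\<lambda>t. f (1 - t))"
    if "continuous_on {..1 / 2} f" for f :: "real \<Rightarrow> real"
    by (rule continuous_on_compose2[OF that]) (auto intro!: continuous_intros)
  have mid: "1 - t = 1 / 2" if "t = 1 / 2" for t :: real using that by simp
  show "continuous_on {0..1} full_slope"
    unfolding full_slope_def
    by (rule continuous_on_cases_le[OF 1[OF continuous_slope] continuous_on_minus[OF 2[OF continuous_slope]] continuous_on_id])
       (simp only: mid slope_half minus_zero)
  show "continuous_on {0..1} full_slope'"
    unfolding full_slope'_def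
    by (rule continuous_on_cases_le[OF 1[OF continuous_slope'] 2[OF continuous_slope'] continuous_on_id])
       (simp only: mid)
qed

lemma full_slope_reflect: "full_slope (1 - x) = - full_slope x"
proof (cases "x = 1 / 2")
  case True
  then have "1 - x = 1 / 2" "x = 1 / 2" by auto
  then show ?thesis by (simp only: full_slope_def slope_half) simp
qed (auto simp: full_slope_def)

lemma full_slope_integral:
  assumes "x \<in> {0..1}"
  shows "full_slope x = full_slope 0 + integral {0..x} full_slope'"
proof -
  have "(full_slope' has_integral (full_slope x - full_slope 0)) {0..x}"
  proof (rule fundamental_theorem_of_calculus_interior_strong[where S="{\<epsilon>, 1 / 2, 1 - \<epsilon>}"])
    show "continuous_on {0..x} full_slope"
      by (rule continuous_on_subset[OF continuous_full_slope]) (use assms in auto)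
    fix y assume y: "y \<in> {0<..<x} - {\<epsilon>, 1 / 2, 1 - \<epsilon>}"
    have "(full_slope has_real_derivative full_slope' y) (at y)"
    proof (cases "y < 1 / 2")
      case True
      have "(slope has_real_derivative slope' y) (at y)" using True y by (intro slope_deriv) auto
      then have "(full_slope has_real_derivative slope' y) (at y)"
        by (rule has_field_derivative_transform_within_open[where S="{..<1 / 2}"])
           (use True in \<open>auto simp: full_slope_def\<close>)
      then show ?thesis using True by (simp add: full_slope'_def)
    next
      case False
      then have y2: "1 / 2 < y" "1 - y \<noteq> \<epsilon>" using y by auto
      have "((\<lambda>y. - slope (1 - y)) has_real_derivative - (slope' (1 - y) * (0 - 1))) (at y)"
        using y2 by (intro DERIV_minus DERIV_chain2[where f=slope] slope_deriv DERIV_diff DERIV_const DERIV_ident) auto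
      then have "((\<lambda>y. - slope (1 - y)) has_real_derivative slope' (1 - y)) (at y)" by simp
      then have "(full_slope has_real_derivative slope' (1 - y)) (at y)"
        by (rule has_field_derivative_transform_within_open[where S="{1 / 2<..}"])
           (use y2 in \<open>auto simp: full_slope_def\<close>)
      then show ?thesis using y2 by (simp add: full_slope'_def)
    qed
    then show "(full_slope has_vector_derivative full_slope' y) (at y)"
      by (simp add: has_real_derivative_iff_has_vector_derivative)
  qed (use assms in auto)
  then have "integral {0..x} full_slope' = full_slope x - full_slope 0" by (rule integral_unique)
  then show ?thesis by simp
qed

lemma graph_0 [simp]: "graph 0 = 0"
  by (simp add: graph_def)

text \<open>Oddness of the slope about 1/2, integrated. The value at 1 stays in the formula because
  its vanishing is deduced from the case x = 1.\<close>

lemma graph_reflect: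
  assumes "x \<in> {0..1}"
  shows "graph 1 - graph (1 - x) = - graph x"
proof -
  have int: "full_slope integrable_on {0..1}"
    using continuous_full_slope by (rule integrable_continuous_interval)
  have "(full_slope has_integral graph x) {0..x}"
    unfolding graph_def using assms by (intro integrable_integral integrable_subinterval_real[OF int]) auto
  then have "((\<lambda>y. full_slope (1 - y)) has_integral graph x) {1 - x..1}"
    using has_integral_reflect_1[of full_slope "graph x" 0 x] by simp
  then have "((\<lambda>y. - full_slope y) has_integral graph x) {1 - x..1}"
    by (simp add: full_slope_reflect)
  from has_integral_neg[OF this] have "(full_slope has_integral - graph x) {1 - x..1}"
    by simp
  then have "integral {1 - x..1} full_slope = - graph x" by (rule integral_unique)
  moreover have "integral {0..1 - x} full_slope + integral {1 - x..1} full_slope = integral {0..1} full_slope"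
    using assms int by (intro Henstock_Kurzweil_Integration.integral_combine) auto
  ultimately show ?thesis by (simp add: graph_def)
qed

lemma graph_1 [simp]: "graph 1 = 0"
  using graph_reflect[of 1] by simp

lemma graph_sym: "x \<in> {0..1} \<Longrightarrow> graph x = graph (1 - x)"
  using graph_reflect[of x] by simp

lemma graph_half: "graph (1 / 2) = \<epsilon> * tan \<alpha> + arc_height p \<alpha> / scale"
proof -
  have "graph (1 / 2) = integral {0..1 / 2} slope"
    unfolding graph_def by (rule integral_cong) (simp add: full_slope_def)
  then show ?thesis using slope_has_integral by (simp add: integral_unique)
qed

text \<open>Concavity: the slope at x is at most the average slope over [0, x] and at least the
  average over [x, 1/2].\<close>

lemma graph_above_chord:
  assumes "x \<in> {0..1 / 2}"
  shows "2 * x * graph (1 / 2) \<le> graph x"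
proof -
  have int: "full_slope integrable_on {0..1}"
    using continuous_full_slope by (rule integrable_continuous_interval)
  have "integral {0..x} (\<lambda>_. slope x) \<le> integral {0..x} full_slope"
    using assms by (intro integral_le integrable_subinterval_real[OF int])
                   (auto simp: full_slope_def intro: slope_antimono)
  then have 1: "x * slope x \<le> graph x" using assms by (simp add: graph_def)
  have "integral {x..1 / 2} full_slope \<le> integral {x..1 / 2} (\<lambda>_. slope x)"
    using assms by (intro integral_le integrable_subinterval_real[OF int])
                   (auto simp: full_slope_def intro: slope_antimono)
  moreover have "integral {0..x} full_slope + integral {x..1 / 2} full_slope = integral {0..1 / 2} full_slope"
    using assms by (intro Henstock_Kurzweil_Integration.integral_combine integrable_subinterval_real[OF int]) auto
  ultimately have 2: "graph (1 / 2) - graph x \<le> (1 / 2 - x) * slope x" using assms by (simp add: graph_def)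
  have "x * (graph (1 / 2) - graph x) \<le> x * ((1 / 2 - x) * slope x)"
    using 2 assms by (intro mult_left_mono) auto
  also have "\<dots> = (1 / 2 - x) * (x * slope x)" by simp
  also have "\<dots> \<le> (1 / 2 - x) * graph x" using 1 assms by (intro mult_left_mono) auto
  finally show ?thesis by (simp add: algebra_simps)
qed

lemma full_slope_powr_integrable:
  "full_slope' absolutely_integrable_on {0..1}" "(\<lambda>x. \<bar>full_slope' x\<bar> powr p) absolutely_integrable_on {0..1}"
proof -
  show "full_slope' absolutely_integrable_on {0..1}"
    by (rule absolutely_integrable_continuous_real[OF continuous_full_slope'])
  show "(\<lambda>x. \<bar>full_slope' x\<bar> powr p) absolutely_integrable_on {0..1}"
    using p_gt_1
    by (intro absolutely_integrable_continuous_real continuous_on_powr' continuous_intros continuous_full_slope') auto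
qed

lemma graph_W2p: "W2p p graph"
  unfolding W2p_def
proof (intro exI conjI ballI)
  show "set_integrable lebesgue {0..1} full_slope'" "set_integrable lebesgue {0..1} (\<lambda>x. \<bar>full_slope' x\<bar> powr p)"
    by (rule full_slope_powr_integrable)+
  show "continuous_on {0..1} full_slope" by (rule continuous_full_slope)
  fix x :: real assume x: "x \<in> {0..1}"
  have "(LINT t:{0..x}|lebesgue. full_slope' t) = integral {0..x} full_slope'"
    using x by (intro set_lebesgue_integral_eq_integral absolutely_integrable_on_subinterval[OF full_slope_powr_integrable(1)]) auto
  then show "full_slope x = full_slope 0 + (LINT t:{0..x}|lebesgue. full_slope' t)"
    using full_slope_integral[OF x] by (simp only:)
  have "(LINT t:{0..x}|lebesgue. full_slope t) = integral {0..x} full_slope"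
    using x by (intro set_lebesgue_integral_eq_integral absolutely_integrable_continuous_real
                  continuous_on_subset[OF continuous_full_slope]) auto
  then show "graph x = graph 0 + (LINT t:{0..x}|lebesgue. full_slope t)"
    by (simp add: graph_def)
qed

text \<open>The segment points in the direction \<alpha> and so drops out of the integral of sin
  \<alpha> - u' cos \<alpha>; for the arc, the rotation identity leaves
  \<open>sin_int p \<alpha> / scale\<close>.\<close>

lemma graph_energy: "Ep p graph = 2 * (scale powr (p - 1) * sin_int p \<alpha>)"
proof -
  let ?e = "\<lambda>x. \<bar>elastic_weight p (full_slope x) * full_slope' x\<bar> powr p"
  let ?d = "\<lambda>x. scale powr p * (sin \<alpha> - cos \<alpha> * slope x)"
  have E: "Ep p graph = integral {0..1} ?e"
    by (rule Ep_eq_integral[OF p_gt_1 full_slope_powr_integrable continuous_full_slope full_slope_integral])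
       (simp_all add: graph_def)
  have "((\<lambda>x. sin \<alpha>) has_integral sin \<alpha> / 2) {0..1 / 2::real}"
    using has_integral_const_real[of "sin \<alpha>" 0 "1 / 2"] by simp
  then have d: "(?d has_integral scale powr p * (sin \<alpha> / 2 - cos \<alpha> * graph (1 / 2))) {0..1 / 2}"
    using slope_has_integral unfolding graph_half by (intro has_integral_mult_right has_integral_diff)
  have e1: "?e x = ?d x" if "x \<in> {0..1 / 2}" for x
    using that slope_energy_density[of x] by (simp add: full_slope_def full_slope'_def)
  have e2: "?e x = ?d (1 - x)" if "x \<in> {1 / 2..1}" for x
  proof (cases "x = 1 / 2")
    case True
    then have "1 - x = x" by simp
    then show ?thesis using e1[of x] True by (simp only:) simp
  next
    case False
    then have "?e x = \<bar>elastic_weight p (slope (1 - x)) * slope' (1 - x)\<bar> powr p"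
      using that by (simp add: full_slope_def full_slope'_def elastic_weight_def)
    then show ?thesis using slope_energy_density[of "1 - x"] that by simp
  qed
  have 1: "(?e has_integral scale powr p * (sin \<alpha> / 2 - cos \<alpha> * graph (1 / 2))) {0..1 / 2}"
    by (rule has_integral_eq[OF _ d]) (use e1 in auto)
  have "((\<lambda>x. ?d (1 - x)) has_integral scale powr p * (sin \<alpha> / 2 - cos \<alpha> * graph (1 / 2))) {1 / 2..1}"
    using has_integral_reflect_1[OF d] by simp
  then have 2: "(?e has_integral scale powr p * (sin \<alpha> / 2 - cos \<alpha> * graph (1 / 2))) {1 / 2..1}"
    by (rule has_integral_eq[rotated]) (use e2 in auto)
  have "Ep p graph = 2 * (scale powr p * (sin \<alpha> / 2 - cos \<alpha> * graph (1 / 2)))"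
    unfolding E using has_integral_combine[OF _ _ 1 2] by (simp add: integral_unique)
  also have "sin \<alpha> / 2 - cos \<alpha> * graph (1 / 2) = sin_int p \<alpha> / scale"
  proof -
    have c: "cos \<alpha> > 0" using \<alpha> by (intro cos_gt_zero) auto
    have w: "(1 / 2 - \<epsilon>) * scale = arc_width p \<alpha>" using \<epsilon> by (simp add: scale_def)
    have "cos \<alpha> * (\<epsilon> * tan \<alpha>) = \<epsilon> * sin \<alpha>" using c by (simp add: tan_def)
    then have "sin \<alpha> / 2 - cos \<alpha> * graph (1 / 2) = (1 / 2 - \<epsilon>) * sin \<alpha> - cos \<alpha> * arc_height p \<alpha> / scale"
      unfolding graph_half distrib_left by (simp only:) (simp add: algebra_simps)
    also have "\<dots> = (((1 / 2 - \<epsilon>) * scale) * sin \<alpha> - cos \<alpha> * arc_height p \<alpha>) / scale"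
      using scale_pos by (simp add: diff_divide_distrib)
    also have "\<dots> = sin_int p \<alpha> / scale"
      unfolding w using arc_rotate(1)[of \<alpha>] by (simp add: mult.commute)
    finally show ?thesis .
  qed
  also have "scale powr p * (sin_int p \<alpha> / scale) = scale powr (p - 1) * sin_int p \<alpha>"
  proof -
    have "scale powr p = scale powr (p - 1) * scale powr 1" by (simp only: powr_add[symmetric]) simp
    then show ?thesis using scale_pos by simp
  qed
  finally show ?thesis .
qed

end

section \<open>Minimization over a symmetric cone obstacle\<close>

text \<open>A negative value at 0 puts the left affine piece below the chord from the origin to the
  tip. A symmetric graph that is concave on the left half and vanishes at 0 therefore only has to
  clear the tip.\<close>

lemma sym_cone_obstacle_bounds:
  assumes c: "sym_cone_obstacle \<psi>" and o: "obstacle_assms \<psi>"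
  shows "0 < \<psi> (1/2)" and "x \<in> {0..1/2} \<Longrightarrow> \<psi> x \<le> 2 * x * \<psi> (1/2)"
    and "x \<in> {0..1} \<Longrightarrow> \<psi> x = \<psi> (1 - x)"
proof -
  obtain a b where ab: "\<And>x. x \<in> {0..1/2} \<Longrightarrow> \<psi> x = a * x + b"
    using c unfolding sym_cone_obstacle_def by blast
  have sym: "\<psi> x = \<psi> (1 - x)" if "x \<in> {0..1}" for x
    using c that unfolding sym_cone_obstacle_def by blast
  then show "x \<in> {0..1} \<Longrightarrow> \<psi> x = \<psi> (1 - x)" .
  have b: "b < 0" using o ab[of 0] unfolding obstacle_assms_def by simp
  have chord: "\<psi> x \<le> 2 * x * \<psi> (1/2)" if x: "x \<in> {0..1/2}" for x
  proof -
    have "2 * x * \<psi> (1/2) - \<psi> x = (- b) * (1 - 2 * x)"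
      using ab[OF x] ab[of "1/2"] by (simp add: algebra_simps)
    moreover have "(- b) * (1 - 2 * x) \<ge> 0" using b x by (intro mult_nonneg_nonneg) auto
    ultimately show ?thesis by linarith
  qed
  then show "x \<in> {0..1/2} \<Longrightarrow> \<psi> x \<le> 2 * x * \<psi> (1/2)" .
  obtain x0 where x0: "x0 \<in> {0<..<1}" "\<psi> x0 > 0" using o unfolding obstacle_assms_def by blast
  define y where "y = min x0 (1 - x0)"
  have y: "0 < y" "y \<in> {0..1/2}" using x0 by (auto simp: y_def min_def)
  have "\<psi> y > 0" using x0 sym[of x0] by (auto simp: y_def min_def)
  then have "0 < 2 * y * \<psi> (1/2)" using chord[OF y(2)] by linarith
  then show "0 < \<psi> (1/2)" using y(1) by (simp add: zero_less_mult_iff)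
qed

lemma (in arc_graph) graph_mem_Msym:
  assumes \<psi>: "sym_cone_obstacle \<psi>" "obstacle_assms \<psi>" and h: "\<psi> (1/2) \<le> graph (1/2)"
  shows "graph \<in> Msym p \<psi>"
proof -
  note bounds = sym_cone_obstacle_bounds[OF \<psi>]
  have left: "\<psi> x \<le> graph x" if x: "x \<in> {0..1/2}" for x
  proof -
    have "\<psi> x \<le> 2 * x * \<psi> (1/2)" by (rule bounds(2)[OF x])
    also have "\<dots> \<le> 2 * x * graph (1/2)" using h x by (intro mult_left_mono) auto
    also have "\<dots> \<le> graph x" by (rule graph_above_chord[OF x])
    finally show ?thesis .
  qed
  have "\<psi> x \<le> graph x" if x: "x \<in> {0..1}" for x
  proof (cases "x \<le> 1/2")
    case True then show ?thesis using left x by auto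
  next
    case False
    then have "\<psi> (1 - x) \<le> graph (1 - x)" using x by (intro left) auto
    then show ?thesis using bounds(3)[OF x] graph_sym[OF x] by linarith
  qed
  then show ?thesis unfolding Msym_def Mset_def by (auto simp: graph_W2p intro: graph_sym)
qed

context elastic_exponent
begin

text \<open>At the critical angle the arc shrunk to width 1/2 has height exactly h, and its scale is
  the optimal one, so the lower bound is attained.\<close>

lemma critical_arc_graph:
  assumes h: "h > 0" and b: "0 < b" "b < pi / 2" "arc_height p b / arc_width p b = 2 * h"
  shows "arc_graph p b 0" and "arc_graph.graph p b 0 (1/2) = h"
    and "Ep p (arc_graph.graph p b 0) = 2 * arc_energy p h b"
proof -
  show "arc_graph p b 0" by unfold_locales (use b in auto)
  then interpret G: arc_graph p b 0 .
  have s: "G.scale = 2 * arc_width p b" by (simp add: G.scale_def)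
  have X: "arc_width p b > 0" using arc_width_pos[of b] b by simp
  show "G.graph (1/2) = h"
    using b(3) X by (simp add: G.graph_half s field_simps)
  have B: "sin_int p b > 0" using sin_int_pos[of b] b by simp
  have tilt: "tilt h b = sin_int p b / G.scale"
  proof -
    have "h = arc_height p b / arc_width p b / 2" using b(3) by simp
    then have "tilt h b = (arc_width p b * sin b - arc_height p b * cos b) / G.scale"
      using X by (simp add: tilt_def s field_simps)
    then show ?thesis by (simp only: arc_rotate)
  qed
  have "arc_energy p h b = G.scale powr (p - 1) * sin_int p b"
  proof -
    have "sin_int p b powr p = sin_int p b powr (p - 1) * sin_int p b powr 1"
      by (simp only: powr_add[symmetric]) simp
    then show ?thesis using B G.scale_pos by (simp add: arc_energy_def tilt powr_divide)
  qed
  then show "Ep p G.graph = 2 * arc_energy p h b" by (simp add: G.graph_energy)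
qed

lemma subcritical_minimizer:
  assumes \<psi>: "sym_cone_obstacle \<psi>" "obstacle_assms \<psi>" and sub: "\<psi> (1/2) < critical_height"
  shows "\<exists>u. is_minimizer p (Msym p \<psi>) u \<and>
                 (\<forall>w. is_minimizer p (Msym p \<psi>) w \<longrightarrow> (\<forall>x\<in>{0..1}. w x = u x))"
proof -
  define h where "h = \<psi> (1/2)"
  have h: "h > 0" unfolding h_def by (rule sym_cone_obstacle_bounds[OF \<psi>])
  obtain b where b: "0 < b" "b < pi / 2" "arc_height p b / arc_width p b = 2 * h"
    using critical_angle_exists[OF h] sub by (auto simp: h_def)
  note G = critical_arc_graph[OF h b]
  define u where "u = arc_graph.graph p b 0"
  have uM: "u \<in> Msym p \<psi>"
    unfolding u_def by (rule arc_graph.graph_mem_Msym[OF G(1) \<psi>]) (simp add: G(2) h_def)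
  have Eu: "Ep p u = 2 * arc_energy p h b" unfolding u_def by (rule G(3))
  have mem: "W2p p v" "v 0 = 0" "v 1 = 0" "\<forall>x\<in>{0..1}. v x = v (1 - x)" "h \<le> v (1/2)" if "v \<in> Msym p \<psi>" for v
  proof -
    have v: "v \<in> Mset p \<psi>" and sym: "\<forall>x\<in>{0..1}. v x = v (1 - x)"
      using that unfolding Msym_def by blast+
    then show "W2p p v" "v 0 = 0" "v 1 = 0" unfolding Mset_def by blast+
    show "\<forall>x\<in>{0..1}. v x = v (1 - x)" by (rule sym)
    have "\<forall>x\<in>{0..1}. \<psi> x \<le> v x" using v unfolding Mset_def by blast
    then show "h \<le> v (1/2)" unfolding h_def by (rule bspec) auto
  qed
  have "Ep p u \<le> Ep p v" if vM: "v \<in> Msym p \<psi>" for v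
  proof -
    obtain a where a: "0 < a" "a < pi / 2" "tilt h a > 0" "2 * arc_energy p h a \<le> Ep p v"
      by (rule energy_lower_bound[OF mem(1-3)[OF vM] h mem(5)[OF vM]])
    have "arc_energy p h b \<le> arc_energy p h a"
      using arc_energy_unique_min[OF h b a(1-3)] by (cases "a = b") auto
    then show ?thesis using a(4) Eu by linarith
  qed
  then have min: "is_minimizer p (Msym p \<psi>) u" using uM by (simp add: is_minimizer_def)
  moreover have "w x = u x" if w: "is_minimizer p (Msym p \<psi>) w" and x: "x \<in> {0..1}" for w x
  proof -
    have wM: "w \<in> Msym p \<psi>" and Ew: "Ep p w \<le> 2 * arc_energy p h b"
      using w uM Eu unfolding is_minimizer_def by auto
    show ?thesis
      by (rule symmetric_minimal_unique[OF b h mem[OF wM] Ew mem[OF uM] eq_refl[OF Eu] x])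
  qed
  ultimately show ?thesis by blast
qed

lemma supercritical_competitor:
  assumes h: "h > 0" and E: "2 * arc_energy p h (pi / 2) < E"
  obtains \<alpha> \<epsilon> where "arc_graph p \<alpha> \<epsilon>" "h \<le> arc_graph.graph p \<alpha> \<epsilon> (1/2)" "Ep p (arc_graph.graph p \<alpha> \<epsilon>) < E"
proof -
  \<comment> \<open>Width h cot a of a segment that reaches the height h by itself; the arc on top
    of it overshoots. This costs nothing in the limit: as a tends to pi/2 the width tends to 0, and
    the tilt at pi/2 is 1/2 for every h.\<close>
  define e where "e a = h * cos a / sin a" for a
  define F where "F a = 2 * ((arc_width p a / (1/2 - e a)) powr (p - 1) * sin_int p a)" for a
  have pi2: "0 < pi / 2" "pi / 2 < pi" "- pi < pi / 2" using pi_gt_zero by linarith+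
  have X: "arc_width p (pi / 2) = sin_int p (pi / 2)" by (simp add: arc_width_def)
  have B: "sin_int p (pi / 2) > 0" using pi2 by (intro sin_int_pos) auto
  have "F (pi / 2) = 2 * arc_energy p h (pi / 2)"
  proof -
    have "sin_int p (pi / 2) powr p = sin_int p (pi / 2) powr (p - 1) * sin_int p (pi / 2) powr 1"
      by (simp only: powr_add[symmetric]) simp
    then show ?thesis using B by (simp add: F_def e_def X arc_energy_def tilt_def powr_divide powr_mult)
  qed
  note width = arc_deriv(1)[OF pi2(1,2), THEN DERIV_isCont] and height = arc_deriv(2)[OF pi2(1,2), THEN DERIV_isCont]
  have ce: "isCont e (pi / 2)" unfolding e_def by (intro continuous_intros) auto
  have cB: "isCont (sin_int p) (pi / 2)" using sin_int_deriv[OF pi2(3)] by (rule DERIV_isCont)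
  have cF: "isCont F (pi / 2)"
    unfolding F_def using B by (intro continuous_intros width ce cB) (auto simp: e_def X)
  have "\<forall>\<^sub>F a in at (pi / 2). F a < E"
    using cF E \<open>F (pi / 2) = 2 * arc_energy p h (pi / 2)\<close> unfolding isCont_def by (intro order_tendstoD(2)) auto
  moreover have "\<forall>\<^sub>F a in at (pi / 2). e a < 1 / 2"
    using order_tendstoD(2)[OF ce[unfolded isCont_def], of "1 / 2"] by (simp add: e_def)
  moreover have "\<forall>\<^sub>F a in at (pi / 2). arc_height p a > 0"
  proof (rule order_tendstoD(1)[OF height[unfolded isCont_def]])
    show "0 < arc_height p (pi / 2)" using p_gt_1 by (simp add: arc_height_def sin_pow_def)
  qed
  ultimately have "\<forall>\<^sub>F a in at (pi / 2). F a < E \<and> e a < 1 / 2 \<and> arc_height p a > 0"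
    by eventually_elim auto
  then have "\<forall>\<^sub>F a in at_left (pi / 2). F a < E \<and> e a < 1 / 2 \<and> arc_height p a > 0"
    by (simp add: eventually_at_split)
  moreover have "\<forall>\<^sub>F a in at_left (pi / 2). 0 < a \<and> a < pi / 2"
    using eventually_at_left_real[OF pi2(1)] by simp
  ultimately have "\<forall>\<^sub>F a in at_left (pi / 2). (F a < E \<and> e a < 1 / 2 \<and> arc_height p a > 0) \<and> 0 < a \<and> a < pi / 2"
    by eventually_elim auto
  then obtain a where a: "F a < E" "e a < 1 / 2" "arc_height p a > 0" "0 < a" "a < pi / 2"
    using eventually_happens[of _ "at_left (pi / 2)"] trivial_limit_at_left_real by blast
  have c: "cos a > 0" "sin a > 0" using a(4,5) by (auto intro: cos_gt_zero sin_gt_zero)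
  have e0: "e a \<ge> 0" using c h by (simp add: e_def)
  have G: "arc_graph p a (e a)" by unfold_locales (use a e0 in auto)
  then interpret G: arc_graph p a "e a" .
  show ?thesis
  proof (rule that[OF G])
    have "e a * tan a = h" using c by (simp add: e_def tan_def)
    then show "h \<le> G.graph (1/2)" unfolding G.graph_half using a(3) G.scale_pos by simp
    show "Ep p G.graph < E" using a(1) by (simp add: G.graph_energy G.scale_def F_def)
  qed
qed

lemma supercritical_no_minimizer:
  assumes \<psi>: "sym_cone_obstacle \<psi>" "obstacle_assms \<psi>" and sup: "critical_height \<le> \<psi> (1/2)"
  shows "\<not> (\<exists>u. is_minimizer p (Mset p \<psi>) u)"
proof
  assume "\<exists>u. is_minimizer p (Mset p \<psi>) u"
  then obtain u where u: "u \<in> Mset p \<psi>" "\<And>v. v \<in> Mset p \<psi> \<Longrightarrow> Ep p u \<le> Ep p v"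
    unfolding is_minimizer_def by blast
  define h where "h = \<psi> (1/2)"
  have h: "h > 0" unfolding h_def by (rule sym_cone_obstacle_bounds[OF \<psi>])
  have "W2p p u" "u 0 = 0" "u 1 = 0" "h \<le> u (1/2)" using u(1) unfolding Mset_def h_def by auto
  then obtain a where a: "0 < a" "a < pi / 2" "tilt h a > 0" "2 * arc_energy p h a \<le> Ep p u"
    using energy_lower_bound[of u h] h by blast
  have "arc_energy p h (pi / 2) < arc_energy p h a"
  proof (rule arc_energy_less_left[OF h a(1,2) _ a(3)])
    fix x assume x: "a < x" "x < pi / 2"
    have "arc_height p x / arc_width p x < arc_height p (pi / 2) / arc_width p (pi / 2)"
      using a x by (intro arc_ratio_strict_mono) auto
    also have "\<dots> \<le> 2 * h" using sup by (simp add: critical_height_def h_def)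
    finally show "arc_height p x / arc_width p x < 2 * h" .
  qed simp
  then have "2 * arc_energy p h (pi / 2) < Ep p u" using a(4) by linarith
  then obtain \<alpha> \<epsilon> where G: "arc_graph p \<alpha> \<epsilon>" "h \<le> arc_graph.graph p \<alpha> \<epsilon> (1/2)"
      "Ep p (arc_graph.graph p \<alpha> \<epsilon>) < Ep p u"
    by (rule supercritical_competitor[OF h])
  have "arc_graph.graph p \<alpha> \<epsilon> \<in> Msym p \<psi>"
    using G(2) by (intro arc_graph.graph_mem_Msym[OF G(1) \<psi>]) (simp add: h_def)
  then have "arc_graph.graph p \<alpha> \<epsilon> \<in> Mset p \<psi>" by (simp add: Msym_def)
  from u(2)[OF this] G(3) show False by linarith
qed

end

theorem theorem1p2:
  fixes p :: real
  assumes "p > 1"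
  shows "\<exists>h>0. \<forall>\<psi>. sym_cone_obstacle \<psi> \<and> obstacle_assms \<psi> \<longrightarrow>
           (\<psi> (1/2) < h \<longrightarrow>
              (\<exists>u. is_minimizer p (Msym p \<psi>) u \<and>
                 (\<forall>w. is_minimizer p (Msym p \<psi>) w \<longrightarrow> (\<forall>x\<in>{0..1}. w x = u x)))) \<and>
           (\<psi> (1/2) \<ge> h \<longrightarrow> \<not> (\<exists>u. is_minimizer p (Mset p \<psi>) u))"
proof -
  interpret elastic_exponent p by unfold_locales (rule assms)
  show ?thesis
  proof (intro exI[of _ critical_height] conjI allI impI critical_height_pos; elim conjE)
    fix \<psi> assume \<psi>: "sym_cone_obstacle \<psi>" "obstacle_assms \<psi>"
    show "\<exists>u. is_minimizer p (Msym p \<psi>) u \<and>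
                 (\<forall>w. is_minimizer p (Msym p \<psi>) w \<longrightarrow> (\<forall>x\<in>{0..1}. w x = u x))"
      if "\<psi> (1/2) < critical_height" using \<psi> that by (rule subcritical_minimizer)
    show "\<not> (\<exists>u. is_minimizer p (Mset p \<psi>) u)"
      if "\<psi> (1/2) \<ge> critical_height" using \<psi> that by (rule supercritical_no_minimizer)
  qed
qed

end
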